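(* Let $\mathcal{X}$ be an action space with mean payoff function $f$, and suppose that Assumptions (A1), (A2), (A3) listed in the context hold for a semi-metric $\ell$ and constants $\nu_1,\nu_2>0$ and $0<\rho<1$. Let $d<+\infty$ be the $(4\nu_1/\nu_2,\nu_2)$-near-optimality dimension of $f$ with respect to $\ell$. Then, for all horizons $n>0$ and all depth limits $\hat H>0$ (integers), the expected cumulative regret of the algorithm LD-HOO (run with parameters $\nu_1,\rho,\hat H$) satisfies $$\mathbb{E}[R_n]\in O\left(\rho^{\hat H}n+\rho^{-\hat H(d+1)}\log n+\hat H\max\{\rho^{\hat H(1-d)},\hat H\}\right),$$ where the implied constant does not depend on $n$ or $\hat H$.
   Context: **Bandit problem.** At each time step $t=1,2,\ldots$ a decision maker selects a (possibly random) action $X_t\in\mathcal{X}$ and receives a random reward $Y_t\in[0,1]$. Given $X_t=x$, the reward $Y_t$ has mean $f(x)$; its distribution is stationary and independent of the past given $X_t$. The function $f:\mathcal{X}\to\mathbb{R}$ is unknown to the decision maker and attains its maximum at $x^*\in\mathcal{X}$. The regret considered is $R_n=nf(x^* )-\sum_{t=1}^n f(X_t)$. **Hierarchical partition.** $\mathcal{X}$ is split successively into cells $\mathcal{X}_{h,i}$, $h\ge 0$, $0\le i\le 2^h-1$, arranged as a binary tree: $\mathcal{X}_{0,0}=\mathcal{X}$, and each $\mathcal{X}_{h,i}$ is partitioned into its two children cells. The children of node $(h,i)$ are $\mathcal{C}(h,i)=\{(h+1,2i),(h+1,2i+1)\}$. **Assumptions.** (A1) $\mathcal{X}$ is equipped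 with a semi-metric $\ell:\mathcal{X}\times\mathcal{X}\to\mathbb{R}$: for all $x,x'$, $\ell(x,x')\ge0$, $\ell(x,x')=\ell(x',x)$, and $\ell(x,x')=0$ iff $x=x'$. Write $\mathrm{diam}(U)=\sup_{x,x'\in U}\ell(x,x')$ and $\mathcal{B}(x,\varepsilon)=\{x'\in\mathcal{X}:\ell(x,x')<\varepsilon\}$. (A2) There are constants $\nu_1,\nu_2>0$ and $0<\rho<1$ such that for all $h\ge0$ and $i\in\{0,\ldots,2^h-1\}$ there is $x_{h,i}\in\mathcal{X}_{h,i}$ with $\mathrm{diam}(\mathcal{X}_{h,i})\le\nu_1\rho^h$, $\mathcal{B}(x_{h,i},\nu_2\rho^h)\subset\mathcal{X}_{h,i}$, and $\mathcal{B}(x_{h,i},\nu_2\rho^h)\cap\mathcal{B}(x_{h,j},\nu_2\rho^h)=\emptyset$ for $i\ne j$. (A3) For all $x,x'\in\mathcal{X}$, $f(x^* )-f(x')\le f(x^* )-f(x)+\max\{f(x^* )-f(x),\ell(x,x')\}$. **Near-optimality dimension.** For $\varepsilon>0$ let $\mathcal{X}_\varepsilon=\{x\in\mathcal{X}: f(x)\ge f(x^* )-\varepsilon\}$. For a set $A\subset\mathcal{X}$, the $\varepsilon$-packing number $\mathcal{N}(A,\ell,\varepsilon)$ is the largest integer $K$ for which there are $x_1,\ldots,x_K\in A$ with $\mathcal{B}(x_k,\varepsilon)\subset A$ for all $k$ and the balls $\mathcal{B}(x_k,\varepsilon)$ pairwise disjoint. For $c>0,\varepsilon_0>0$, the $(c,\varepsilon_0)$-near-optimality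 dimension of $f$ with respect to $\ell$ is $$d=\inf\{\delta\ge0:\ \exists C>0\ \text{s.t.}\ \forall\, 0<\varepsilon\le\varepsilon_0,\ \mathcal{N}(\mathcal{X}_{c\varepsilon},\ell,\varepsilon)\le C\varepsilon^{-\delta}\},\qquad \inf\emptyset=+\infty.$$ When $d<+\infty$ it is understood to be the smallest such value, i.e. there is $C>0$ with $\mathcal{N}(\mathcal{X}_{c\varepsilon},\ell,\varepsilon)\le C\varepsilon^{-d}$ for all $0<\varepsilon\le\varepsilon_0$. **Algorithm LD-HOO** (parameters $\nu_1,\rho$, depth limit $\hat H$). It maintains trees $\mathcal{T}_t$ of nodes, with $\mathcal{T}_1=\{(0,0)\}$. At round $t$ it selects a leaf $(h_t,i_t)$ of $\mathcal{T}_t$ and plays an arbitrary action $X_t\in\mathcal{X}_{h_t,i_t}$. Let $T_{h,i}(t)$ be the number of rounds $\tau\le t$ in which the selected node $(h_\tau,i_\tau)$ is $(h,i)$ or a descendant of $(h,i)$. At round $t$, let $T=T_{h,i}(t-1)$ be the count before the round, and let $\hat\mu$ be the average of the rewards $Y_\tau$ over the corresponding rounds $\tau\le t-1$. If $T>0$, then $$u_{h,i}(t)=\hat\mu+\sqrt{\frac{2\log t}{T}}+\nu_1\rho^h,$$ $$b_{h,i}(t)=\min\Big\{u_{h,i}(t),\max_{c\in\mathcal{C}(h,i)}b_c(t)\Big\}\ \text{ if } h<\hat H,\qquad b_{\hat H,i}(t)=u_{\hat H,i}(t).$$ If $T=0$, then $u_{h,i}(t)=b_{h,i}(t)=+\infty$.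 The leaf $(h_t,i_t)$ is found by starting at $(0,0)$ and repeatedly moving to a child with largest $b$-value (ties broken arbitrarily) until a leaf of $\mathcal{T}_t$ is reached. After $Y_t$ is observed, if $h_t<\hat H$ then $\mathcal{T}_{t+1}=\mathcal{T}_t\cup\mathcal{C}(h_t,i_t)$; otherwise $\mathcal{T}_{t+1}=\mathcal{T}_t$. *)

theory Defs
  imports "HOL-Probability.Probability"
begin

section \<open>Semi-metric spaces and hierarchical partitions\<close>

definition semi_metric_on :: "'a set \<Rightarrow> ('a \<Rightarrow> 'a \<Rightarrow> real) \<Rightarrow> bool" where
  "semi_metric_on S l \<longleftrightarrow>
     (\<forall>x\<in>S. \<forall>x'\<in>S. l x x' \<ge> 0 \<and> l x x' = l x' x \<and> (l x x' = 0 \<longleftrightarrow> x = x'))"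

text \<open>The diameter is extended-real-valued, since the real-valued supremum is unspecified on
  unbounded sets.\<close>

definition sm_diam :: "('a \<Rightarrow> 'a \<Rightarrow> real) \<Rightarrow> 'a set \<Rightarrow> ereal" where
  "sm_diam l U = (SUP (x, x') \<in> U \<times> U. ereal (l x x'))"

definition sm_ball :: "'a set \<Rightarrow> ('a \<Rightarrow> 'a \<Rightarrow> real) \<Rightarrow> 'a \<Rightarrow> real \<Rightarrow> 'a set" where
  "sm_ball S l x \<epsilon> = {x' \<in> S. l x x' < \<epsilon>}"

definition binary_partition :: "'a set \<Rightarrow> (nat \<Rightarrow> nat \<Rightarrow> 'a set) \<Rightarrow> bool" where
  "binary_partition S P \<longleftrightarrow>
     P 0 0 = S \<and>
     (\<forall>h. \<forall>i<2^h. P h i = P (h + 1) (2 * i) \<union> P (h + 1) (2 * i + 1) \<and>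
                  P (h + 1) (2 * i) \<inter> P (h + 1) (2 * i + 1) = {})"

definition well_shaped_cells ::
  "'a set \<Rightarrow> ('a \<Rightarrow> 'a \<Rightarrow> real) \<Rightarrow> (nat \<Rightarrow> nat \<Rightarrow> 'a set) \<Rightarrow> real \<Rightarrow> real \<Rightarrow> real \<Rightarrow> bool" where
  "well_shaped_cells S l P \<nu>1 \<nu>2 \<rho> \<longleftrightarrow>
     \<nu>1 > 0 \<and> \<nu>2 > 0 \<and> 0 < \<rho> \<and> \<rho> < 1 \<and>
     (\<exists>c. \<forall>h. \<forall>i<2^h.
        c h i \<in> P h i \<and>
        sm_diam l (P h i) \<le> ereal (\<nu>1 * \<rho> ^ h) \<and>
        sm_ball S l (c h i) (\<nu>2 * \<rho> ^ h) \<subseteq> P h i \<and>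
        (\<forall>j<2^h. i \<noteq> j \<longrightarrow>
           sm_ball S l (c h i) (\<nu>2 * \<rho> ^ h) \<inter> sm_ball S l (c h j) (\<nu>2 * \<rho> ^ h) = {}))"

section \<open>The mean-payoff function\<close>

definition is_maximizer :: "'a set \<Rightarrow> ('a \<Rightarrow> real) \<Rightarrow> 'a \<Rightarrow> bool" where
  "is_maximizer S f xs \<longleftrightarrow> xs \<in> S \<and> (\<forall>x\<in>S. f x \<le> f xs)"

definition weakly_lipschitz ::
  "'a set \<Rightarrow> ('a \<Rightarrow> 'a \<Rightarrow> real) \<Rightarrow> ('a \<Rightarrow> real) \<Rightarrow> 'a \<Rightarrow> bool" where
  "weakly_lipschitz S l f xs \<longleftrightarrow>
     (\<forall>x\<in>S. \<forall>x'\<in>S. f xs - f x' \<le> f xs - f x + max (f xs - f x) (l x x'))"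

definition near_optimal_set :: "'a set \<Rightarrow> ('a \<Rightarrow> real) \<Rightarrow> 'a \<Rightarrow> real \<Rightarrow> 'a set" where
  "near_optimal_set S f xs \<epsilon> = {x \<in> S. f x \<ge> f xs - \<epsilon>}"

text \<open>The packing number is \<open>\<infinity>\<close> if there are arbitrarily large packings.\<close>

definition packing_number ::
  "'a set \<Rightarrow> ('a \<Rightarrow> 'a \<Rightarrow> real) \<Rightarrow> 'a set \<Rightarrow> real \<Rightarrow> enat" where
  "packing_number S l U \<epsilon> =
     Sup {enat K | K. \<exists>x :: nat \<Rightarrow> 'a.
       (\<forall>k<K. x k \<in> U \<and> sm_ball S l (x k) \<epsilon> \<subseteq> U) \<and>
       disjoint_family_on (\<lambda>k. sm_ball S l (x k) \<epsilon>) {..<K}}"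

definition packing_exponent ::
  "'a set \<Rightarrow> ('a \<Rightarrow> 'a \<Rightarrow> real) \<Rightarrow> ('a \<Rightarrow> real) \<Rightarrow> 'a \<Rightarrow> real \<Rightarrow> real \<Rightarrow> real \<Rightarrow> bool" where
  "packing_exponent S l f xs c \<epsilon>0 \<delta> \<longleftrightarrow>
     (\<exists>C>0. \<forall>\<epsilon>. 0 < \<epsilon> \<and> \<epsilon> \<le> \<epsilon>0 \<longrightarrow>
        ereal_of_enat (packing_number S l (near_optimal_set S f xs (c * \<epsilon>)) \<epsilon>)
          \<le> ereal (C * \<epsilon> powr (- \<delta>)))"

definition near_optimality_dim ::
  "'a set \<Rightarrow> ('a \<Rightarrow> 'a \<Rightarrow> real) \<Rightarrow> ('a \<Rightarrow> real) \<Rightarrow> 'a \<Rightarrow> real \<Rightarrow> real \<Rightarrow> ereal" where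
  "near_optimality_dim S l f xs c \<epsilon>0 =
     (INF \<delta> \<in> {\<delta>. \<delta> \<ge> 0 \<and> packing_exponent S l f xs c \<epsilon>0 \<delta>}. ereal \<delta>)"

section \<open>Stochastic bandit environments\<close>

text \<open>The action space is \<open>space A\<close>; the Markov kernel \<open>K\<close> maps an action to its reward
  distribution, which lives on \<open>[0,1]\<close> and has mean \<open>f\<close>.\<close>

definition bandit_env :: "'a measure \<Rightarrow> ('a \<Rightarrow> real measure) \<Rightarrow> ('a \<Rightarrow> real) \<Rightarrow> bool" where
  "bandit_env A K f \<longleftrightarrow>
     K \<in> A \<rightarrow>\<^sub>M prob_algebra borel \<and>
     (\<forall>x\<in>space A. (AE y in K x. y \<in> {0..1}) \<and> (LINT y|K x. y) = f x)"

section \<open>The algorithm LD-HOO\<close>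

type_synonym node = "nat \<times> nat"

definition children :: "node \<Rightarrow> node set" where
  "children = (\<lambda>(h, i). {(h + 1, 2 * i), (h + 1, 2 * i + 1)})"

definition descendants :: "node \<Rightarrow> node set" where
  "descendants v = {(v, w) | v w. w \<in> children v}\<^sup>* `` {v}"

text \<open>Throughout, \<open>node\<close> and \<open>y\<close> are the sequences of selected nodes and rewards of one
  realisation of the process. Rounds are numbered from \<open>1\<close>; the values at \<open>0\<close> are irrelevant.\<close>

definition visits :: "(nat \<Rightarrow> node) \<Rightarrow> node \<Rightarrow> nat \<Rightarrow> nat set" where
  "visits node v t = {\<tau> \<in> {1..t}. node \<tau> \<in> descendants v}"

definition visit_count :: "(nat \<Rightarrow> node) \<Rightarrow> node \<Rightarrow> nat \<Rightarrow> nat" where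
  "visit_count node v t = card (visits node v t)"

definition mean_reward :: "(nat \<Rightarrow> node) \<Rightarrow> (nat \<Rightarrow> real) \<Rightarrow> node \<Rightarrow> nat \<Rightarrow> real" where
  "mean_reward node y v t = (\<Sum>\<tau>\<in>visits node v t. y \<tau>) / real (visit_count node v t)"

definition u_value ::
  "real \<Rightarrow> real \<Rightarrow> (nat \<Rightarrow> node) \<Rightarrow> (nat \<Rightarrow> real) \<Rightarrow> nat \<Rightarrow> node \<Rightarrow> ereal" where
  "u_value \<nu>1 \<rho> node y t v =
     (if visit_count node v (t - 1) = 0 then \<infinity>
      else ereal (mean_reward node y v (t - 1)
                  + sqrt (2 * ln (real t) / real (visit_count node v (t - 1)))
                  + \<nu>1 * \<rho> ^ fst v))"

function b_value_aux ::
  "real \<Rightarrow> real \<Rightarrow> nat \<Rightarrow> (nat \<Rightarrow> node) \<Rightarrow> (nat \<Rightarrow> real) \<Rightarrow> nat \<Rightarrow> nat \<Rightarrow> nat \<Rightarrow> ereal" where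
  "b_value_aux \<nu>1 \<rho> H node y t h i =
     (if visit_count node (h, i) (t - 1) = 0 then \<infinity>
      else if h < H then
        min (u_value \<nu>1 \<rho> node y t (h, i))
            (max (b_value_aux \<nu>1 \<rho> H node y t (h + 1) (2 * i))
                 (b_value_aux \<nu>1 \<rho> H node y t (h + 1) (2 * i + 1)))
      else u_value \<nu>1 \<rho> node y t (h, i))"
  by pat_completeness auto
termination
  by (relation "Wellfounded.measure (\<lambda>(\<nu>1, \<rho>, H, node, y, t, h, i). H - h)") auto

declare b_value_aux.simps [simp del]

definition b_value ::
  "real \<Rightarrow> real \<Rightarrow> nat \<Rightarrow> (nat \<Rightarrow> node) \<Rightarrow> (nat \<Rightarrow> real) \<Rightarrow> nat \<Rightarrow> node \<Rightarrow> ereal" where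
  "b_value \<nu>1 \<rho> H node y t v = b_value_aux \<nu>1 \<rho> H node y t (fst v) (snd v)"

text \<open>\<open>tree_after H node t\<close> is the tree after \<open>t\<close> completed rounds, i.e. the tree
  \<open>T\<close> with index \<open>t + 1\<close>.\<close>

primrec tree_after :: "nat \<Rightarrow> (nat \<Rightarrow> node) \<Rightarrow> nat \<Rightarrow> node set" where
  "tree_after H node 0 = {(0, 0)}"
| "tree_after H node (Suc t) =
     (if fst (node (Suc t)) < H then tree_after H node t \<union> children (node (Suc t))
      else tree_after H node t)"

definition is_leaf :: "node set \<Rightarrow> node \<Rightarrow> bool" where
  "is_leaf T v \<longleftrightarrow> v \<in> T \<and> children v \<inter> T = {}"

inductive greedy_path :: "node set \<Rightarrow> (node \<Rightarrow> ereal) \<Rightarrow> node \<Rightarrow> bool"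
  for T b where
  root: "greedy_path T b (0, 0)"
| step: "greedy_path T b v \<Longrightarrow> \<not> is_leaf T v \<Longrightarrow> is_arg_max b (\<lambda>w. w \<in> children v) w
           \<Longrightarrow> greedy_path T b w"

definition ld_hoo_selects ::
  "real \<Rightarrow> real \<Rightarrow> nat \<Rightarrow> (nat \<Rightarrow> node) \<Rightarrow> (nat \<Rightarrow> real) \<Rightarrow> nat \<Rightarrow> node \<Rightarrow> bool" where
  "ld_hoo_selects \<nu>1 \<rho> H node y t v \<longleftrightarrow>
     greedy_path (tree_after H node (t - 1)) (b_value \<nu>1 \<rho> H node y t) v \<and>
     is_leaf (tree_after H node (t - 1)) v"

text \<open>A run of LD-HOO on a probability space \<open>M\<close>. The \<open>\<sigma>\<close>-algebra \<open>F t\<close> is the information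
  available when \<open>Y t\<close> is drawn: it contains the past, the choices of round \<open>t\<close> and possibly
  private randomness of the decision maker, so ties and actions within a cell are resolved
  in an arbitrary, possibly random, non-anticipating way. Conditionally on \<open>F t\<close>, the reward
  \<open>Y t\<close> has law \<open>K (X t)\<close>.\<close>

locale ld_hoo_run = prob_space M + filtration "space M" F
  for M :: "'w measure" and F :: "nat \<Rightarrow> 'w measure" +
  fixes A :: "'a measure" and K :: "'a \<Rightarrow> real measure" and P :: "nat \<Rightarrow> nat \<Rightarrow> 'a set"
    and \<nu>1 \<rho> :: real and H :: nat
    and node :: "nat \<Rightarrow> 'w \<Rightarrow> node" and X :: "nat \<Rightarrow> 'w \<Rightarrow> 'a" and Y :: "nat \<Rightarrow> 'w \<Rightarrow> real"
  assumes F_subalgebra: "\<And>t. subalgebra M (F t)"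
    and node_measurable: "\<And>t. t \<ge> 1 \<Longrightarrow> node t \<in> F t \<rightarrow>\<^sub>M count_space UNIV"
    and X_measurable: "\<And>t. t \<ge> 1 \<Longrightarrow> X t \<in> F t \<rightarrow>\<^sub>M A"
    and Y_measurable: "\<And>t. t \<ge> 1 \<Longrightarrow> Y t \<in> F (Suc t) \<rightarrow>\<^sub>M borel"
    and reward_law: "\<And>t B. t \<ge> 1 \<Longrightarrow> B \<in> sets borel \<Longrightarrow>
          AE \<omega> in M. real_cond_exp M (F t) (\<lambda>\<omega>'. indicator B (Y t \<omega>')) \<omega> = measure (K (X t \<omega>)) B"
    and node_selected: "\<And>t \<omega>. t \<ge> 1 \<Longrightarrow> \<omega> \<in> space M \<Longrightarrow>
          ld_hoo_selects \<nu>1 \<rho> H (\<lambda>s. node s \<omega>) (\<lambda>s. Y s \<omega>) t (node t \<omega>)"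
    and action_in_cell: "\<And>t \<omega>. t \<ge> 1 \<Longrightarrow> \<omega> \<in> space M \<Longrightarrow>
          X t \<omega> \<in> P (fst (node t \<omega>)) (snd (node t \<omega>))"

definition regret :: "('a \<Rightarrow> real) \<Rightarrow> 'a \<Rightarrow> (nat \<Rightarrow> 'w \<Rightarrow> 'a) \<Rightarrow> nat \<Rightarrow> 'w \<Rightarrow> real" where
  "regret f xs X n \<omega> = real n * f xs - (\<Sum>t=1..n. f (X t \<omega>))"

end

theory Submission
  imports Defs
begin

text \<open>Call a node of depth \<open>h\<close> near-optimal if its cell contains a point whose gap is at most
  \<open>2 \<nu>1 \<rho>^h\<close>. All points of such a cell have gap at most \<open>4 \<nu>1 \<rho>^h\<close>, so the inscribed balls form
  a packing and there are \<open>O(\<rho>^(- h d))\<close> near-optimal nodes of depth \<open>h\<close>. Every round falls into one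
  of four classes. If the empirical mean of some node on a fixed optimal branch of depth \<open>H\<close>
  deviates, the gap is at most \<open>1\<close>; this costs \<open>O(H)\<close> in expectation. If a near-optimal leaf of depth
  \<open>H\<close> is played, the gap is \<open>O(\<rho>^H)\<close>. A near-optimal leaf of smaller depth is expanded when it is
  played, hence is played only once. Otherwise the path enters a node that is not near-optimal
  from a near-optimal parent, and the \<open>u\<close>-value of that node exceeds the optimum, which forces its
  visit count below \<open>8 ln n / (\<nu>1 \<rho>^h)^2\<close> unless its own empirical mean deviates.

  Deviation probabilities are \<open>O(t^(-3))\<close>: with \<open>S\<close> the accumulated noise and \<open>T\<close> the visit count
  of a node, \<open>exp (z S - z^2 T / 8)\<close> is a supermartingale, and a union bound over the values of \<open>T\<close>
  handles the randomness of \<open>T\<close>.\<close>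

section \<open>Trajectories of LD-HOO\<close>

lemma children_iff: "w \<in> children v \<longleftrightarrow> w = (fst v + 1, 2 * snd v) \<or> w = (fst v + 1, 2 * snd v + 1)"
  by (auto simp: children_def split: prod.splits)

lemma fst_child: "w \<in> children v \<Longrightarrow> fst w = Suc (fst v)"
  by (auto simp: children_iff)

lemma finite_children: "finite (children v)"
  and card_children: "card (children v) = 2"
  by (auto simp: children_def split: prod.splits)

lemma descendants_self: "v \<in> descendants v"
  by (auto simp: descendants_def)

lemma child_in_descendants: "w \<in> descendants v \<Longrightarrow> c \<in> children w \<Longrightarrow> c \<in> descendants v"
  unfolding descendants_def by (blast intro: rtrancl_into_rtrancl)

lemma descendants_child_subset: "c \<in> children v \<Longrightarrow> descendants c \<subseteq> descendants v"
  unfolding descendants_def by (blast intro: converse_rtrancl_into_rtrancl)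

lemma descendants_induct [consumes 1, case_names self child]:
  assumes "w \<in> descendants v" "Q v"
    and "\<And>w c. w \<in> descendants v \<Longrightarrow> Q w \<Longrightarrow> c \<in> children w \<Longrightarrow> Q c"
  shows "Q w"
proof -
  have "(v, w) \<in> {(v, w) |v w. w \<in> children v}\<^sup>*"
    using assms(1) by (simp add: descendants_def)
  then show ?thesis
    by (induction rule: rtrancl_induct) (use assms(2,3) in \<open>auto simp: descendants_def\<close>)
qed

text \<open>The type \<open>node\<close> allows every pair of naturals, while the partition and the
  cell assumptions speak only of indices below \<open>2 ^ h\<close>; this predicate singles out the
  nodes of the binary tree.\<close>

definition valid_node :: "node \<Rightarrow> bool" where
  "valid_node v \<longleftrightarrow> snd v < 2 ^ fst v"

lemma valid_node_child: "valid_node v \<Longrightarrow> c \<in> children v \<Longrightarrow> valid_node c"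
  by (auto simp: valid_node_def children_iff)

lemma finite_visits: "finite (visits node v t)"
  by (simp add: visits_def)

lemma visits_child_subset: "c \<in> children v \<Longrightarrow> visits node c t \<subseteq> visits node v t"
  using descendants_child_subset[of c v] by (auto simp: visits_def)

lemma visit_count_child_le: "c \<in> children v \<Longrightarrow> visit_count node c t \<le> visit_count node v t"
  unfolding visit_count_def by (intro card_mono finite_visits visits_child_subset)

lemma tree_after_mono: "s \<le> t \<Longrightarrow> tree_after H node s \<subseteq> tree_after H node t"
  by (induction t) (auto simp: le_Suc_eq)

lemma tree_after_depth_le: "v \<in> tree_after H node t \<Longrightarrow> fst v \<le> H"
  by (induction t) (auto split: if_splits dest: fst_child)

section \<open>Behaviour of \<open>b\<close>-values along the tree\<close>

lemma b_value_unvisited: "visit_count node v (t - 1) = 0 \<Longrightarrow> b_value \<nu>1 \<rho> H node y t v = \<infinity>"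
  by (simp add: b_value_def b_value_aux.simps)

lemma b_value_bottom:
  "visit_count node v (t - 1) \<noteq> 0 \<Longrightarrow> \<not> fst v < H \<Longrightarrow>
   b_value \<nu>1 \<rho> H node y t v = u_value \<nu>1 \<rho> node y t v"
  by (simp add: b_value_def b_value_aux.simps)

lemma b_value_inner:
  "visit_count node v (t - 1) \<noteq> 0 \<Longrightarrow> fst v < H \<Longrightarrow>
   b_value \<nu>1 \<rho> H node y t v = min (u_value \<nu>1 \<rho> node y t v)
     (max (b_value \<nu>1 \<rho> H node y t (fst v + 1, 2 * snd v))
          (b_value \<nu>1 \<rho> H node y t (fst v + 1, 2 * snd v + 1)))"
  unfolding b_value_def by (subst b_value_aux.simps) simp

lemma b_value_le_u_value: "b_value \<nu>1 \<rho> H node y t v \<le> u_value \<nu>1 \<rho> node y t v"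
proof (cases "visit_count node v (t - 1) = 0")
  case True
  then show ?thesis by (simp add: u_value_def)
next
  case False
  then show ?thesis
    by (cases "fst v < H") (simp_all add: b_value_inner b_value_bottom)
qed

text \<open>The minimum in the recursion is at most the larger child value, which the best child
  attains; if \<open>v\<close> is unvisited, so is \<open>c\<close>, and both values are infinite.
  Hence \<open>b\<close>-values cannot drop during a greedy descent.\<close>

lemma b_value_le_best_child:
  assumes "fst v < H" and best: "is_arg_max (b_value \<nu>1 \<rho> H node y t) (\<lambda>w. w \<in> children v) c"
  shows "b_value \<nu>1 \<rho> H node y t v \<le> b_value \<nu>1 \<rho> H node y t c"
proof -
  have c: "c \<in> children v" and max: "\<And>w. w \<in> children v \<Longrightarrow>
      b_value \<nu>1 \<rho> H node y t w \<le> b_value \<nu>1 \<rho> H node y t c"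
    using best by (auto simp: is_arg_max_linorder)
  show ?thesis
  proof (cases "visit_count node v (t - 1) = 0")
    case True
    then have "visit_count node c (t - 1) = 0"
      using visit_count_child_le[OF c, of node "t - 1"] by simp
    then show ?thesis by (simp add: b_value_unvisited)
  next
    case False
    then show ?thesis
      using assms(1) max by (auto simp: b_value_inner children_iff intro!: min.coboundedI2)
  qed
qed

lemma b_value_ge_child:
  assumes "fst v < H" and c: "c \<in> children v"
    and "z \<le> u_value \<nu>1 \<rho> node y t v" and "z \<le> b_value \<nu>1 \<rho> H node y t c"
  shows "z \<le> b_value \<nu>1 \<rho> H node y t v"
proof (cases "visit_count node v (t - 1) = 0")
  case True
  then show ?thesis by (simp add: b_value_unvisited)
next
  case False
  then show ?thesis
    using assms by (auto simp: b_value_inner children_iff le_max_iff_disj)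
qed

text \<open>Indexes the path by depth, so that it can be compared level by level with the optimal
  branch and searched for its first node that is not near-optimal.\<close>

lemma greedy_path_trace:
  assumes "greedy_path T b w"
  obtains p where "p 0 = (0, 0)" "p (fst w) = w" "\<And>k. k \<le> fst w \<Longrightarrow> fst (p k) = k"
    "\<And>k. k < fst w \<Longrightarrow> is_arg_max b (\<lambda>w. w \<in> children (p k)) (p (Suc k))"
proof -
  have "\<exists>p. p 0 = (0, 0) \<and> p (fst w) = w \<and> (\<forall>k\<le>fst w. fst (p k) = k) \<and>
    (\<forall>k<fst w. is_arg_max b (\<lambda>w. w \<in> children (p k)) (p (Suc k)))"
    using assms
  proof induction
    case root
    show ?case by (rule exI[of _ "\<lambda>_. (0, 0)"]) simp
  next
    case (step v w)
    then obtain p where p: "p 0 = (0, 0)" "p (fst v) = v" "\<forall>k\<le>fst v. fst (p k) = k"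
      "\<forall>k<fst v. is_arg_max b (\<lambda>w. w \<in> children (p k)) (p (Suc k))"
      by blast
    have w: "fst w = Suc (fst v)"
      using step by (intro fst_child) (simp add: is_arg_max_def)
    show ?case
      by (rule exI[of _ "p(fst w := w)"]) (use p w step in \<open>auto simp: less_Suc_eq le_Suc_eq\<close>)
  qed
  then show ?thesis using that by blast
qed

section \<open>Reward noise and confidence intervals\<close>

definition reward_noise ::
  "('a \<Rightarrow> real) \<Rightarrow> (nat \<Rightarrow> node) \<Rightarrow> (nat \<Rightarrow> 'a) \<Rightarrow> (nat \<Rightarrow> real) \<Rightarrow> node \<Rightarrow> nat \<Rightarrow> real" where
  "reward_noise f node x y v t = (\<Sum>\<tau>\<in>visits node v t. y \<tau> - f (x \<tau>))"

text \<open>The confidence radius \<open>sqrt (2 * ln t / T)\<close> is multiplied by the count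
  \<open>T\<close>, so that sums are compared instead of averages. As in \<open>u_value\<close>, the
  count stops at \<open>t - 1\<close> while the logarithm uses \<open>t\<close>.\<close>

definition deviates ::
  "('a \<Rightarrow> real) \<Rightarrow> (nat \<Rightarrow> node) \<Rightarrow> (nat \<Rightarrow> 'a) \<Rightarrow> (nat \<Rightarrow> real) \<Rightarrow> node \<Rightarrow> nat \<Rightarrow> bool" where
  "deviates f node x y v t \<longleftrightarrow> visit_count node v (t - 1) > 0 \<and>
     sqrt (2 * ln (real t) * real (visit_count node v (t - 1)))
       < \<bar>reward_noise f node x y v (t - 1)\<bar>"

lemma mean_reward_concentrated:
  assumes "\<not> deviates f node x y v t" and pos: "visit_count node v (t - 1) > 0"
  defines "c \<equiv> real (visit_count node v (t - 1))"
  shows "\<bar>mean_reward node y v (t - 1) - (\<Sum>\<tau>\<in>visits node v (t - 1). f (x \<tau>)) / c\<bar>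
           \<le> sqrt (2 * ln (real t) / c)"
proof -
  have c: "c > 0" using pos by (simp add: c_def)
  have "mean_reward node y v (t - 1) - (\<Sum>\<tau>\<in>visits node v (t - 1). f (x \<tau>)) / c
      = reward_noise f node x y v (t - 1) / c"
    by (simp add: mean_reward_def reward_noise_def c_def sum_subtractf diff_divide_distrib)
  moreover have "\<bar>reward_noise f node x y v (t - 1) / c\<bar> \<le> sqrt (2 * ln (real t) * c) / c"
    using assms(1) pos c by (simp add: deviates_def c_def abs_divide divide_right_mono)
  moreover have "sqrt (2 * ln (real t) * c) / c = sqrt (2 * ln (real t) / c)"
    using c by (simp add: real_sqrt_mult real_sqrt_divide field_simps)
  ultimately show ?thesis by simp
qed

section \<open>Gaps within cells and near-optimal nodes\<close>

locale weakly_lipschitz_cells =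
  fixes S :: "'a set" and f :: "'a \<Rightarrow> real" and xs :: 'a and l :: "'a \<Rightarrow> 'a \<Rightarrow> real"
    and P :: "nat \<Rightarrow> nat \<Rightarrow> 'a set" and \<nu>1 \<rho> :: real
  assumes maximizer: "is_maximizer S f xs"
    and partition: "binary_partition S P"
    and lipschitz: "weakly_lipschitz S l f xs"
    and \<nu>1_pos: "\<nu>1 > 0" and \<rho>_pos: "\<rho> > 0" and \<rho>_less_1: "\<rho> < 1"
    and dist_le: "\<And>h i x x'. i < 2 ^ h \<Longrightarrow> x \<in> P h i \<Longrightarrow> x' \<in> P h i \<Longrightarrow> l x x' \<le> \<nu>1 * \<rho> ^ h"
begin

definition cell :: "node \<Rightarrow> 'a set" where
  "cell v = P (fst v) (snd v)"

text \<open>A witness in the cell stands in for the supremum of \<open>f\<close> over the cell, which need not be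
  attained.\<close>

definition near_optimal :: "node \<Rightarrow> bool" where
  "near_optimal v \<longleftrightarrow> valid_node v \<and> (\<exists>x\<in>cell v. f xs - f x \<le> 2 * \<nu>1 * \<rho> ^ fst v)"

lemma cell_root: "cell (0, 0) = S"
  using partition unfolding cell_def binary_partition_def fst_conv snd_conv by (rule conjunct1)

lemma cell_eq_children:
  "valid_node v \<Longrightarrow> cell v = cell (fst v + 1, 2 * snd v) \<union> cell (fst v + 1, 2 * snd v + 1)"
  using partition unfolding cell_def binary_partition_def valid_node_def fst_conv snd_conv
  by (elim conjE allE impE) assumption+

lemma cell_child_subset: "valid_node v \<Longrightarrow> c \<in> children v \<Longrightarrow> cell c \<subseteq> cell v"
  using cell_eq_children[of v] by (auto simp: children_iff)

lemma cell_descendant: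
  assumes "w \<in> descendants v" "valid_node v"
  shows "valid_node w \<and> cell w \<subseteq> cell v"
  using assms(1)
proof (induction rule: descendants_induct)
  case (child w c)
  then show ?case using cell_child_subset valid_node_child by blast
qed (use assms in auto)

lemma cell_subset: "valid_node v \<Longrightarrow> cell v \<subseteq> S"
proof (induction "fst v" arbitrary: v)
  case 0
  then have "v = (0, 0)" by (auto simp: valid_node_def prod_eq_iff)
  then show ?case by (simp add: cell_root)
next
  case (Suc h)
  define u where "u = (h, snd v div 2)"
  have "snd v < 2 * 2 ^ h"
    using Suc(2,3) by (simp add: valid_node_def flip: power_Suc)
  then have "valid_node u"
    by (auto simp: u_def valid_node_def)
  moreover have "v \<in> children u"
    using Suc(2) by (auto simp: u_def children_iff prod_eq_iff)
  ultimately show ?case using Suc(1)[of u] cell_child_subset[of u v] by (auto simp: u_def)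
qed

text \<open>Applying the weak Lipschitz condition from the witness \<open>z\<close> gives at most
  \<open>2 * g + max (2 * g) g = 4 * g\<close>, where
  \<open>g = \<nu>1 * \<rho> ^ fst v\<close>.\<close>

lemma gap_in_near_optimal_cell:
  assumes "near_optimal v" "x \<in> cell v"
  shows "f xs - f x \<le> 4 * \<nu>1 * \<rho> ^ fst v"
proof -
  obtain z where z: "valid_node v" "z \<in> cell v" "f xs - f z \<le> 2 * \<nu>1 * \<rho> ^ fst v"
    using assms(1) by (auto simp: near_optimal_def)
  have "l z x \<le> \<nu>1 * \<rho> ^ fst v"
    using z assms(2) by (intro dist_le) (auto simp: cell_def valid_node_def)
  moreover have "f xs - f x \<le> f xs - f z + max (f xs - f z) (l z x)"
    using lipschitz z assms(2) cell_subset unfolding weakly_lipschitz_def by blast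
  moreover have "0 < \<nu>1 * \<rho> ^ fst v" using \<nu>1_pos \<rho>_pos by simp
  ultimately show ?thesis using z by linarith
qed

text \<open>With the maximiser as base point its own gap vanishes, and the weak Lipschitz condition
  leaves only the diameter of the cell.\<close>

lemma gap_in_optimal_cell:
  assumes "valid_node v" "xs \<in> cell v" "x \<in> cell v"
  shows "f xs - f x \<le> \<nu>1 * \<rho> ^ fst v"
proof -
  have "l xs x \<le> \<nu>1 * \<rho> ^ fst v"
    using assms by (intro dist_le) (auto simp: cell_def valid_node_def)
  moreover have "f xs - f x \<le> f xs - f xs + max (f xs - f xs) (l xs x)"
    using lipschitz assms cell_subset unfolding weakly_lipschitz_def by blast
  moreover have "0 < \<nu>1 * \<rho> ^ fst v" using \<nu>1_pos \<rho>_pos by simp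
  ultimately show ?thesis by linarith
qed

lemma optimal_cell_near_optimal: "valid_node v \<Longrightarrow> xs \<in> cell v \<Longrightarrow> near_optimal v"
  using \<nu>1_pos \<rho>_pos unfolding near_optimal_def by (intro conjI bexI[of _ xs]) simp_all

lemma near_optimal_root: "near_optimal (0, 0)"
  using maximizer
  by (intro optimal_cell_near_optimal) (simp_all add: valid_node_def cell_root is_maximizer_def)

text \<open>A cell is the union of its two child cells, so one child of a cell containing
  \<open>xs\<close> contains \<open>xs\<close> again; dependent choice assembles these into an
  infinite branch.\<close>

lemma optimal_branch_exists:
  obtains os where "os 0 = (0, 0)" "\<And>s. os (Suc s) \<in> children (os s)" "\<And>s. fst (os s) = s"
    "\<And>s. valid_node (os s)" "\<And>s. xs \<in> cell (os s)"
proof -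
  define Q where "Q n v \<longleftrightarrow> fst v = n \<and> valid_node v \<and> xs \<in> cell v" for n v
  have "\<exists>g. \<forall>n. Q n (g n) \<and> g (Suc n) \<in> children (g n)"
  proof (rule dependent_nat_choice)
    show "\<exists>x. Q 0 x"
      using maximizer
      by (auto simp: Q_def valid_node_def cell_root is_maximizer_def intro!: exI[of _ "(0,0)"])
  next
    fix v n assume v: "Q n v"
    then have "xs \<in> cell (fst v + 1, 2 * snd v) \<or> xs \<in> cell (fst v + 1, 2 * snd v + 1)"
      using cell_eq_children[of v] by (auto simp: Q_def)
    then obtain c where "c \<in> children v" "xs \<in> cell c" by (auto simp: children_iff)
    then show "\<exists>c. Q (Suc n) c \<and> c \<in> children v"
      using v fst_child[of c v] valid_node_child[of v c] unfolding Q_def by blast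
  qed
  then obtain g where g: "\<And>n. Q n (g n)" "\<And>n. g (Suc n) \<in> children (g n)" by blast
  have "g 0 = (0, 0)" using g(1)[of 0] by (auto simp: Q_def valid_node_def prod_eq_iff)
  with g show ?thesis by (intro that[of g]) (auto simp: Q_def)
qed

definition near_optimal_nodes :: "nat \<Rightarrow> node set" where
  "near_optimal_nodes h = {v. fst v = h \<and> near_optimal v}"

lemma finite_near_optimal_nodes: "finite (near_optimal_nodes h)"
proof (rule finite_subset)
  show "near_optimal_nodes h \<subseteq> {h} \<times> {..<2 ^ h}"
    by (auto simp: near_optimal_nodes_def near_optimal_def valid_node_def)
qed simp

text \<open>These are the candidates for the first node on a path that is not near-optimal. The
  index \<open>h\<close> is the depth of the parent, so the members have depth
  \<open>Suc h\<close>.\<close>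

definition boundary_nodes :: "nat \<Rightarrow> node set" where
  "boundary_nodes h = {c. \<not> near_optimal c \<and> (\<exists>v\<in>near_optimal_nodes h. c \<in> children v)}"

lemma boundary_nodes_subset: "boundary_nodes h \<subseteq> (\<Union>v\<in>near_optimal_nodes h. children v)"
  by (auto simp: boundary_nodes_def)

lemma finite_boundary_nodes: "finite (boundary_nodes h)"
  by (rule finite_subset[OF boundary_nodes_subset])
     (simp add: finite_near_optimal_nodes finite_children)

lemma card_boundary_nodes_le: "card (boundary_nodes h) \<le> 2 * card (near_optimal_nodes h)"
proof -
  have "card (boundary_nodes h) \<le> card (\<Union>v\<in>near_optimal_nodes h. children v)"
    by (intro card_mono boundary_nodes_subset) (simp add: finite_near_optimal_nodes finite_children)
  also have "\<dots> \<le> (\<Sum>v\<in>near_optimal_nodes h. card (children v))"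
    by (intro card_UN_le finite_near_optimal_nodes)
  finally show ?thesis by (simp add: card_children mult.commute)
qed

lemma boundary_node_props:
  assumes "c \<in> boundary_nodes h"
  shows "fst c = Suc h" "valid_node c" "\<And>x. x \<in> cell c \<Longrightarrow> 2 * \<nu>1 * \<rho> ^ Suc h < f xs - f x"
proof -
  obtain v where v: "near_optimal v" "fst v = h" "c \<in> children v" "\<not> near_optimal c"
    using assms by (auto simp: boundary_nodes_def near_optimal_nodes_def)
  then show "fst c = Suc h" "valid_node c"
    using fst_child[of c v] valid_node_child[of v c] by (auto simp: near_optimal_def)
  then show "\<And>x. x \<in> cell c \<Longrightarrow> 2 * \<nu>1 * \<rho> ^ Suc h < f xs - f x"
    using v by (force simp: near_optimal_def)
qed

end

section \<open>Deterministic regret analysis of one realisation\<close>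

locale ld_hoo_trajectory = weakly_lipschitz_cells S f xs l P \<nu>1 \<rho>
  for S :: "'a set" and f xs l P \<nu>1 \<rho> +
  fixes H :: nat and node :: "nat \<Rightarrow> node" and x :: "nat \<Rightarrow> 'a" and y :: "nat \<Rightarrow> real"
  assumes selected: "\<And>t. t \<ge> 1 \<Longrightarrow> ld_hoo_selects \<nu>1 \<rho> H node y t (node t)"
    and action: "\<And>t. t \<ge> 1 \<Longrightarrow> x t \<in> P (fst (node t)) (snd (node t))"
begin

abbreviation "uval t \<equiv> u_value \<nu>1 \<rho> node y t"
abbreviation "bval t \<equiv> b_value \<nu>1 \<rho> H node y t"
abbreviation "dev \<equiv> deviates f node x y"

lemma action_in_cell': "t \<ge> 1 \<Longrightarrow> x t \<in> cell (node t)"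
  using action by (simp add: cell_def)

lemma depth_le: "t \<ge> 1 \<Longrightarrow> fst (node t) \<le> H"
  using selected[of t] tree_after_depth_le[of "node t"] by (auto simp: ld_hoo_selects_def is_leaf_def)

text \<open>Playing \<open>v\<close> above depth \<open>H\<close> adds its children to the tree, and
  the tree only grows, so \<open>v\<close> is not a leaf in any later round.\<close>

lemma inner_node_selected_once:
  assumes "1 \<le> s" "s < t" "node s = v" "node t = v" "fst v < H"
  shows False
proof -
  have "children v \<subseteq> tree_after H node s"
    using assms by (cases s) auto
  also have "\<dots> \<subseteq> tree_after H node (t - 1)"
    using assms by (intro tree_after_mono) auto
  finally have "children v \<subseteq> tree_after H node (t - 1)" .
  moreover have "children v \<inter> tree_after H node (t - 1) = {}"
    using selected[of t] assms by (simp add: ld_hoo_selects_def is_leaf_def)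
  moreover have "(fst v + 1, 2 * snd v) \<in> children v" by (simp add: children_iff)
  ultimately show False by blast
qed

lemma card_inner_node_selected:
  assumes "fst v < H"
  shows "card {t\<in>{1..n}. node t = v} \<le> 1"
proof -
  have "a = b" if "a \<in> {t\<in>{1..n}. node t = v}" "b \<in> {t\<in>{1..n}. node t = v}" for a b
    using that inner_node_selected_once[of a b v] inner_node_selected_once[of b a v] assms
    by (cases a b rule: linorder_cases) auto
  then show ?thesis by (simp add: card_le_Suc0_iff_eq)
qed

lemma visited_actions_in_cell:
  assumes "valid_node v" "\<tau> \<in> visits node v t"
  shows "x \<tau> \<in> cell v"
  using assms action_in_cell'[of \<tau>] cell_descendant[of "node \<tau>" v]
  unfolding visits_def mem_Collect_eq atLeastAtMost_iff by blast

text \<open>The average of the means over the visits is within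
  \<open>\<nu>1 * \<rho> ^ fst v\<close> of the optimum, and the noise is within the confidence
  radius; the two bonus terms of the \<open>u\<close>-value cover exactly these two losses.\<close>

lemma optimal_u_value_ge:
  assumes v: "valid_node v" "xs \<in> cell v" and nd: "\<not> dev v t"
  shows "ereal (f xs) \<le> uval t v"
proof (cases "visit_count node v (t - 1) = 0")
  case True
  then show ?thesis by (simp add: u_value_def)
next
  case False
  define c where "c = real (visit_count node v (t - 1))"
  have c: "c > 0" using False by (simp add: c_def)
  define m where "m = (\<Sum>\<tau>\<in>visits node v (t - 1). f (x \<tau>)) / c"
  have "(f xs - \<nu>1 * \<rho> ^ fst v) * c = (\<Sum>\<tau>\<in>visits node v (t - 1). f xs - \<nu>1 * \<rho> ^ fst v)"
    by (simp add: c_def visit_count_def)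
  also have "\<dots> \<le> (\<Sum>\<tau>\<in>visits node v (t - 1). f (x \<tau>))"
    using gap_in_optimal_cell[OF v] visited_actions_in_cell[OF v(1)]
    by (intro sum_mono) (force simp: algebra_simps)
  finally have "f xs - \<nu>1 * \<rho> ^ fst v \<le> m"
    using c by (simp add: m_def pos_le_divide_eq)
  moreover have "\<bar>mean_reward node y v (t - 1) - m\<bar> \<le> sqrt (2 * ln (real t) / c)"
    using mean_reward_concentrated[OF nd] False by (simp add: m_def c_def)
  ultimately have "f xs \<le> mean_reward node y v (t - 1) + sqrt (2 * ln (real t) / c)
      + \<nu>1 * \<rho> ^ fst v"
    by linarith
  then show ?thesis using False by (simp add: u_value_def c_def)
qed

text \<open>All means in the cell lie more than \<open>2 * g\<close> below the optimum, while the
  diameter bonus of the \<open>u\<close>-value restores only one \<open>g\<close>. The other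
  \<open>g\<close> must come from the noise and the confidence bonus, each at most one radius, and
  the radius is that large only for few visits.\<close>

lemma visit_count_le_of_u_value_ge:
  assumes v: "valid_node v" and gap: "\<And>z. z \<in> cell v \<Longrightarrow> 2 * \<nu>1 * \<rho> ^ fst v < f xs - f z"
    and nd: "\<not> dev v t" and u: "ereal (f xs) \<le> uval t v" and t: "1 \<le> t" "t \<le> n"
  shows "real (visit_count node v (t - 1)) \<le> 8 * ln (real n) / (\<nu>1 * \<rho> ^ fst v)\<^sup>2"
proof (cases "visit_count node v (t - 1) = 0")
  case True
  then show ?thesis using t by simp
next
  case False
  define c where "c = real (visit_count node v (t - 1))"
  define g where "g = \<nu>1 * \<rho> ^ fst v"
  have c: "c > 0" using False by (simp add: c_def)
  have g: "g > 0" using \<nu>1_pos \<rho>_pos by (simp add: g_def)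
  define m where "m = (\<Sum>\<tau>\<in>visits node v (t - 1). f (x \<tau>)) / c"
  have "(\<Sum>\<tau>\<in>visits node v (t - 1). f (x \<tau>)) \<le> (\<Sum>\<tau>\<in>visits node v (t - 1). f xs - 2 * g)"
    using gap visited_actions_in_cell[OF v]
    by (intro sum_mono) (force simp: algebra_simps g_def)
  also have "\<dots> = (f xs - 2 * g) * c"
    by (simp add: c_def visit_count_def)
  finally have "m \<le> f xs - 2 * g"
    using c by (simp add: m_def pos_divide_le_eq)
  moreover have "\<bar>mean_reward node y v (t - 1) - m\<bar> \<le> sqrt (2 * ln (real t) / c)"
    using mean_reward_concentrated[OF nd] False by (simp add: m_def c_def)
  moreover have "f xs \<le> mean_reward node y v (t - 1) + sqrt (2 * ln (real t) / c) + g"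
    using u False by (simp add: u_value_def c_def g_def)
  ultimately have "g \<le> 2 * sqrt (2 * ln (real t) / c)"
    by linarith
  \<comment> \<open>Squaring removes the root and produces the constant
    \<open>8 = 2\<^sup>2 * 2\<close>.\<close>
  then have "g\<^sup>2 \<le> (2 * sqrt (2 * ln (real t) / c))\<^sup>2"
    using g by (intro power_mono) auto
  also have "\<dots> = 8 * ln (real t) / c"
    using c t by (simp add: power_mult_distrib)
  also have "\<dots> \<le> 8 * ln (real n) / c"
    using c t by (intro divide_right_mono) auto
  finally show ?thesis
    unfolding c_def[symmetric] g_def[symmetric] using c g by (simp add: field_simps)
qed

lemma optimistic_rounds_count:
  assumes v: "valid_node v" and gap: "\<And>z. z \<in> cell v \<Longrightarrow> 2 * \<nu>1 * \<rho> ^ fst v < f xs - f z"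
    and n: "n \<ge> 1"
  shows "real (card {t\<in>{1..n}. node t \<in> descendants v \<and> ereal (f xs) \<le> uval t v})
      \<le> 8 * ln (real n) / (\<nu>1 * \<rho> ^ fst v)\<^sup>2 + 1 + (\<Sum>t=1..n. of_bool (dev v t))"
proof -
  define B where "B = 8 * ln (real n) / (\<nu>1 * \<rho> ^ fst v)\<^sup>2"
  define E where "E = {t\<in>{1..n}. node t \<in> descendants v \<and> real (visit_count node v (t - 1)) \<le> B}"
  define D where "D = {t\<in>{1..n}. dev v t}"
  have B: "B \<ge> 0" using n by (simp add: B_def)
  have "{t\<in>{1..n}. node t \<in> descendants v \<and> ereal (f xs) \<le> uval t v} \<subseteq> E \<union> D"
    using visit_count_le_of_u_value_ge[OF v gap] by (auto simp: E_def D_def B_def)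
  then have "card {t\<in>{1..n}. node t \<in> descendants v \<and> ereal (f xs) \<le> uval t v} \<le> card (E \<union> D)"
    by (intro card_mono) (auto simp: E_def D_def)
  also have "\<dots> \<le> card E + card D" by (rule card_Un_le)
  finally have *: "real (card {t\<in>{1..n}. node t \<in> descendants v \<and> ereal (f xs) \<le> uval t v})
      \<le> real (card E) + real (card D)" by linarith
  have "real (card E) \<le> B + 1"
  proof (cases "E = {}")
    case True
    then show ?thesis using B by simp
  next
    case False
    \<comment> \<open>Every other round of \<open>E\<close> is a visit of \<open>v\<close> before
      the last round \<open>m\<close>, so \<open>card E - 1\<close> is at most the count before
      \<open>m\<close>; the extra \<open>1\<close> in the bound is round \<open>m\<close>
      itself.\<close>
    define m where "m = Max E"
    have fin: "finite E" by (simp add: E_def)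
    have m: "m \<in> E" using False fin by (simp add: m_def)
    have "E - {m} \<subseteq> visits node v (m - 1)"
    proof
      fix t assume t: "t \<in> E - {m}"
      then have "t \<le> m" using fin by (simp add: m_def)
      then have "t \<in> {1..m - 1}" using t by (auto simp: E_def)
      then show "t \<in> visits node v (m - 1)" using t by (simp add: E_def visits_def)
    qed
    then have "card (E - {m}) \<le> visit_count node v (m - 1)"
      unfolding visit_count_def by (intro card_mono finite_visits)
    moreover have "card E = Suc (card (E - {m}))"
      by (rule card_Suc_Diff1[OF fin m, symmetric])
    moreover have "real (visit_count node v (m - 1)) \<le> B" using m by (simp add: E_def)
    ultimately show ?thesis by linarith
  qed
  moreover have "real (card D) = (\<Sum>t=1..n. of_bool (dev v t))"
    by (simp add: D_def Int_def)
  ultimately show ?thesis using * by (simp add: B_def)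
qed

text \<open>Backward induction from depth \<open>H\<close>, where the recursion ends in the
  \<open>u\<close>-value. It stops at depth \<open>1\<close>, since greedy comparisons only concern
  nodes below the root.\<close>

lemma optimal_b_value_ge:
  assumes os: "\<And>s. os (Suc s) \<in> children (os s)" "\<And>s. fst (os s) = s"
    and u: "\<And>s. 1 \<le> s \<Longrightarrow> s \<le> H \<Longrightarrow> ereal (f xs) \<le> uval t (os s)"
    and s: "1 \<le> s" "s \<le> H"
  shows "ereal (f xs) \<le> bval t (os s)"
  using s(2,1)
proof (induction s rule: inc_induct)
  case base
  then show ?case
    using u[of H] os(2)[of H]
    by (cases "visit_count node (os H) (t - 1) = 0") (auto simp: b_value_unvisited b_value_bottom)
next
  case (step s)
  show ?case
    by (rule b_value_ge_child[OF _ os(1)]) (use step os(2)[of s] u in auto)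
qed

text \<open>Where the path leaves the optimal branch, the chosen child has at least the
  \<open>b\<close>-value of its sibling on that branch; afterwards \<open>b\<close>-values cannot
  decrease along the path.\<close>

lemma greedy_b_value_ge:
  assumes os: "os 0 = (0, 0)" "\<And>s. os (Suc s) \<in> children (os s)" "\<And>s. fst (os s) = s"
    and u: "\<And>s. 1 \<le> s \<Longrightarrow> s \<le> H \<Longrightarrow> ereal (f xs) \<le> uval t (os s)"
    and p: "p 0 = (0, 0)" "\<And>k. k \<le> m \<Longrightarrow> fst (p k) = k"
      "\<And>k. k < m \<Longrightarrow> is_arg_max (bval t) (\<lambda>w. w \<in> children (p k)) (p (Suc k))"
    and m: "m \<le> H" and k: "k \<le> m" "p k \<noteq> os k"
  shows "ereal (f xs) \<le> bval t (p k)"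
  using k
proof (induction k)
  case 0
  then show ?case using os(1) p(1) by simp
next
  case (Suc k)
  show ?case
  proof (cases "p k = os k")
    case True
    have "ereal (f xs) \<le> bval t (os (Suc k))"
      using Suc m by (intro optimal_b_value_ge os u) auto
    also have "\<dots> \<le> bval t (p (Suc k))"
      using p(3)[of k] Suc(2) os(2)[of k] True unfolding is_arg_max_linorder
      by (metis Suc_le_eq)
    finally show ?thesis .
  next
    case False
    then have "ereal (f xs) \<le> bval t (p k)" using Suc by simp
    also have "\<dots> \<le> bval t (p (Suc k))"
      using p(2)[of k] p(3)[of k] Suc(2) m by (intro b_value_le_best_child) auto
    finally show ?thesis .
  qed
qed

text \<open>A round without deviation on the optimal branch either plays in a near-optimal leaf or passes
  through the first node on its path that is not near-optimal; the latter node has left the optimal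
  branch, so that greediness forces its \<open>u\<close>-value above the optimum.\<close>

lemma selected_node_cases:
  assumes t: "t \<ge> 1"
    and os: "os 0 = (0, 0)" "\<And>s. os (Suc s) \<in> children (os s)" "\<And>s. fst (os s) = s"
      "\<And>s. valid_node (os s)" "\<And>s. xs \<in> cell (os s)"
    and nd: "\<And>s. 1 \<le> s \<Longrightarrow> s \<le> H \<Longrightarrow> \<not> dev (os s) t"
  obtains "near_optimal (node t)"
  | h c where "h < H" "c \<in> boundary_nodes h" "node t \<in> descendants c" "ereal (f xs) \<le> uval t c"
      "f xs - f (x t) \<le> 4 * \<nu>1 * \<rho> ^ h"
proof -
  define m where "m = fst (node t)"
  have mH: "m \<le> H" using depth_le[OF t] by (simp add: m_def)
  have "greedy_path (tree_after H node (t - 1)) (bval t) (node t)"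
    using selected[OF t] by (simp add: ld_hoo_selects_def)
  from greedy_path_trace[OF this] obtain p where
    p: "p 0 = (0, 0)" "p m = node t" "\<And>k. k \<le> m \<Longrightarrow> fst (p k) = k"
      "\<And>k. k < m \<Longrightarrow> is_arg_max (bval t) (\<lambda>w. w \<in> children (p k)) (p (Suc k))"
    unfolding m_def by blast
  have pc: "p (Suc k) \<in> children (p k)" if "k < m" for k
    using p(4)[OF that] by (simp add: is_arg_max_def)
  have desc: "node t \<in> descendants (p k)" if "k \<le> m" for k
  proof -
    have "p j \<in> descendants (p k)" if "k \<le> j" "j \<le> m" for j
      using that
    proof (induction j rule: dec_induct)
      case (step j)
      then show ?case using pc[of j] child_in_descendants[of "p j" "p k"] by auto
    qed (rule descendants_self)
    then show ?thesis using that p(2) by (metis order_refl)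
  qed
  show ?thesis
  proof (cases "\<forall>k\<le>m. near_optimal (p k)")
    case True
    then show ?thesis using that(1) p(2) by auto
  next
    case False
    \<comment> \<open>The first node on the path that is not near-optimal; since the root is
      near-optimal, it has a near-optimal parent, at depth \<open>h\<close>.\<close>
    then obtain k where k: "k \<le> m" "\<not> near_optimal (p k)" "\<And>j. j < k \<Longrightarrow> near_optimal (p j)"
      using exists_least_iff[of "\<lambda>k. k \<le> m \<and> \<not> near_optimal (p k)"] by auto
    have "k \<noteq> 0" using k(2) p(1) near_optimal_root by metis
    then obtain h where h: "k = Suc h" by (cases k) auto
    have ph: "near_optimal (p h)" "fst (p h) = h" using k p(3)[of h] by (auto simp: h)
    have "p k \<noteq> os k" using k(2) optimal_cell_near_optimal[OF os(4,5)] by metis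
    then have "ereal (f xs) \<le> bval t (p k)"
      using os p k mH nd optimal_u_value_ge[OF os(4,5)]
      by (intro greedy_b_value_ge[of os t p m]) auto
    then have u: "ereal (f xs) \<le> uval t (p k)"
      using b_value_le_u_value order_trans by blast
    \<comment> \<open>The gap is bounded through the parent \<open>p h\<close>, because
      near-optimality, which bounds gaps from above, fails for \<open>p k\<close>.\<close>
    have "x t \<in> cell (p h)"
      using cell_descendant[OF desc[of h]] ph k(1) h action_in_cell'[OF t]
      by (auto simp: near_optimal_def)
    then have "f xs - f (x t) \<le> 4 * \<nu>1 * \<rho> ^ h"
      using gap_in_near_optimal_cell[OF ph(1)] ph(2) by simp
    moreover have "p k \<in> boundary_nodes h"
      unfolding boundary_nodes_def near_optimal_nodes_def
      using ph k(1,2) pc[of h] by (intro CollectI conjI bexI[of _ "p h"]) (simp_all add: h)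
    ultimately show ?thesis
      using that(2)[of h "p k"] desc[OF k(1)] u k(1) h mH by auto
  qed
qed

text \<open>A charging argument: the three blocks on the right are nonnegative, and in each round
  one of them alone is at least the gap.\<close>

lemma round_gap_le:
  assumes t: "t \<ge> 1" and range: "\<And>z. z \<in> S \<Longrightarrow> 0 \<le> f z \<and> f z \<le> 1"
    and os: "os 0 = (0, 0)" "\<And>s. os (Suc s) \<in> children (os s)" "\<And>s. fst (os s) = s"
      "\<And>s. valid_node (os s)" "\<And>s. xs \<in> cell (os s)"
  shows "f xs - f (x t) \<le> (\<Sum>s=1..H. of_bool (dev (os s) t)) + 4 * \<nu>1 * \<rho> ^ H
    + (\<Sum>h<H. 4 * \<nu>1 * \<rho> ^ h * ((\<Sum>v\<in>near_optimal_nodes h. of_bool (node t = v))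
        + (\<Sum>c\<in>boundary_nodes h. of_bool (node t \<in> descendants c \<and> ereal (f xs) \<le> uval t c))))"
    (is "_ \<le> ?D + ?L + (\<Sum>h<H. ?w h * (?I h + ?J h))")
proof -
  have w: "?w h > 0" for h using \<nu>1_pos \<rho>_pos by simp
  note w0 = less_imp_le[OF w]
  have I0: "?I h \<ge> 0" and J0: "?J h \<ge> 0" for h by (auto intro!: sum_nonneg)
  have D0: "?D \<ge> 0" by (auto intro!: sum_nonneg)
  have sum0: "(\<Sum>h<H. ?w h * (?I h + ?J h)) \<ge> 0"
    by (intro sum_nonneg mult_nonneg_nonneg add_nonneg_nonneg w0 I0 J0)
  \<comment> \<open>A round is paid for at depth \<open>h < H\<close> as soon as its gap is at most
    the weight of this depth and one of the indicators there equals \<open>1\<close>.\<close>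
  have step: "f xs - f (x t) \<le> ?D + ?L + (\<Sum>h<H. ?w h * (?I h + ?J h))"
    if "h < H" "f xs - f (x t) \<le> ?w h" "?I h + ?J h \<ge> 1" for h
  proof -
    have "f xs - f (x t) \<le> ?w h * (?I h + ?J h)"
      using that(2,3) w[of h] mult_left_mono[of 1 "?I h + ?J h" "?w h"] by linarith
    also have "\<dots> \<le> (\<Sum>h<H. ?w h * (?I h + ?J h))"
      using that(1) by (intro member_le_sum mult_nonneg_nonneg add_nonneg_nonneg w0 I0 J0) auto
    finally show ?thesis using D0 w[of H] by linarith
  qed
  show ?thesis
  proof (cases "\<exists>s\<in>{1..H}. dev (os s) t")
    case True
    then obtain s where s: "s \<in> {1..H}" "dev (os s) t" by blast
    have "(1::real) = of_bool (dev (os s) t)" using s by simp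
    also have "\<dots> \<le> ?D" using s by (intro member_le_sum) auto
    finally have "1 \<le> ?D" .
    moreover have "valid_node (node t)"
    proof -
      have "greedy_path (tree_after H node (t - 1)) (bval t) (node t)"
        using selected[OF t] by (simp add: ld_hoo_selects_def)
      then show ?thesis
        by induction (auto simp: valid_node_def is_arg_max_def children_iff)
    qed
    then have "x t \<in> S" using action_in_cell'[OF t] cell_subset by blast
    moreover have "xs \<in> S" using maximizer by (simp add: is_maximizer_def)
    ultimately show ?thesis using range[of "x t"] range[of xs] sum0 w[of H] by linarith
  next
    case False
    show ?thesis
    proof (rule selected_node_cases[OF t os(1) os(2) os(3) os(4) os(5)])
      show "\<not> dev (os s) t" if "1 \<le> s" "s \<le> H" for s using False that by auto
    next
      assume no: "near_optimal (node t)"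
      define h where "h = fst (node t)"
      have gap: "f xs - f (x t) \<le> ?w h"
        using gap_in_near_optimal_cell[OF no action_in_cell'[OF t]] by (simp add: h_def)
      show ?thesis
      proof (cases "h < H")
        case True
        have "1 \<le> ?I h"
          using no finite_near_optimal_nodes[of h]
          by (subst sum.remove[of _ "node t"]) (auto simp: near_optimal_nodes_def h_def intro!: sum_nonneg)
        then show ?thesis using step[OF True gap] J0[of h] by linarith
      next
        case False
        \<comment> \<open>A leaf at the depth limit may be played again and again, so its gap is
          charged to the term that recurs in every round.\<close>
        then have "h = H" using depth_le[OF t] by (simp add: h_def)
        then have "f xs - f (x t) \<le> ?L" using gap by simp
        then show ?thesis using D0 sum0 by linarith
      qed
    next
      fix h c assume h: "h < H" and c: "c \<in> boundary_nodes h" "node t \<in> descendants c"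
        "ereal (f xs) \<le> uval t c" and gap: "f xs - f (x t) \<le> 4 * \<nu>1 * \<rho> ^ h"
      have "1 \<le> ?J h"
        using c finite_boundary_nodes[of h]
        by (subst sum.remove[of _ c]) (auto intro!: sum_nonneg)
      then show ?thesis using step[OF h gap] I0[of h] by linarith
    qed
  qed
qed

text \<open>Exchanging sums turns the indicators of the charging argument into counts per node: at
  most one for a near-optimal node above depth \<open>H\<close>, and the number of optimistic rounds
  for a boundary node.\<close>

lemma trajectory_regret_le:
  assumes n: "n \<ge> 1" and range: "\<And>z. z \<in> S \<Longrightarrow> 0 \<le> f z \<and> f z \<le> 1"
    and os: "os 0 = (0, 0)" "\<And>s. os (Suc s) \<in> children (os s)" "\<And>s. fst (os s) = s"
      "\<And>s. valid_node (os s)" "\<And>s. xs \<in> cell (os s)"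
  shows "(\<Sum>t=1..n. f xs - f (x t)) \<le> (\<Sum>s=1..H. \<Sum>t=1..n. of_bool (dev (os s) t))
    + 4 * \<nu>1 * \<rho> ^ H * real n
    + (\<Sum>h<H. 4 * \<nu>1 * \<rho> ^ h * (real (card (near_optimal_nodes h))
        + (\<Sum>c\<in>boundary_nodes h. 8 * ln (real n) / (\<nu>1 * \<rho> ^ Suc h)\<^sup>2 + 1
            + (\<Sum>t=1..n. of_bool (dev c t)))))"
proof -
  define G where "G c t \<longleftrightarrow> node t \<in> descendants c \<and> ereal (f xs) \<le> uval t c" for c t
  have "(\<Sum>t=1..n. f xs - f (x t)) \<le> (\<Sum>t=1..n. (\<Sum>s=1..H. of_bool (dev (os s) t)) + 4 * \<nu>1 * \<rho> ^ H
    + (\<Sum>h<H. 4 * \<nu>1 * \<rho> ^ h * ((\<Sum>v\<in>near_optimal_nodes h. of_bool (node t = v))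
        + (\<Sum>c\<in>boundary_nodes h. of_bool (G c t)))))"
    unfolding G_def using round_gap_le[OF _ range os] by (intro sum_mono) auto
  also have "\<dots> = (\<Sum>s=1..H. \<Sum>t=1..n. of_bool (dev (os s) t)) + 4 * \<nu>1 * \<rho> ^ H * real n
    + (\<Sum>h<H. 4 * \<nu>1 * \<rho> ^ h * ((\<Sum>v\<in>near_optimal_nodes h. \<Sum>t=1..n. of_bool (node t = v))
        + (\<Sum>c\<in>boundary_nodes h. \<Sum>t=1..n. of_bool (G c t))))"
  proof -
    have "(\<Sum>t=1..n. \<Sum>s=1..H. of_bool (dev (os s) t)) = (\<Sum>s=1..H. \<Sum>t=1..n. of_bool (dev (os s) t) :: real)"
      by (rule sum.swap)
    moreover have "(\<Sum>t=1..n. \<Sum>h<H. 4 * \<nu>1 * \<rho> ^ h * ((\<Sum>v\<in>near_optimal_nodes h. of_bool (node t = v))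
          + (\<Sum>c\<in>boundary_nodes h. of_bool (G c t))))
        = (\<Sum>h<H. \<Sum>t=1..n. 4 * \<nu>1 * \<rho> ^ h * ((\<Sum>v\<in>near_optimal_nodes h. of_bool (node t = v))
          + (\<Sum>c\<in>boundary_nodes h. of_bool (G c t))))"
      by (rule sum.swap)
    moreover have "\<dots> = (\<Sum>h<H. 4 * \<nu>1 * \<rho> ^ h * ((\<Sum>v\<in>near_optimal_nodes h. \<Sum>t=1..n. of_bool (node t = v))
        + (\<Sum>c\<in>boundary_nodes h. \<Sum>t=1..n. of_bool (G c t))))"
      unfolding sum_distrib_left[symmetric] sum.distrib
      by (intro sum.cong refl arg_cong2[where f = "(*)"] arg_cong2[where f = "(+)"] sum.swap)
    ultimately show ?thesis
      unfolding sum.distrib[of _ _ "{1..n}"] by (simp only: sum_constant card_atLeastAtMost) simp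
  qed
  also have "\<dots> \<le> (\<Sum>s=1..H. \<Sum>t=1..n. of_bool (dev (os s) t)) + 4 * \<nu>1 * \<rho> ^ H * real n
    + (\<Sum>h<H. 4 * \<nu>1 * \<rho> ^ h * ((\<Sum>v\<in>near_optimal_nodes h. 1)
        + (\<Sum>c\<in>boundary_nodes h. 8 * ln (real n) / (\<nu>1 * \<rho> ^ Suc h)\<^sup>2 + 1
            + (\<Sum>t=1..n. of_bool (dev c t)))))"
  proof (intro add_mono order_refl sum_mono mult_left_mono)
    fix h v assume "h \<in> {..<H}" "v \<in> near_optimal_nodes h"
    then have "card {t\<in>{1..n}. node t = v} \<le> 1"
      by (intro card_inner_node_selected) (simp add: near_optimal_nodes_def)
    then show "(\<Sum>t=1..n. of_bool (node t = v)) \<le> (1::real)" by (simp add: Int_def)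
  next
    fix h c assume "h \<in> {..<H}" and c: "c \<in> boundary_nodes h"
    have "real (card {t\<in>{1..n}. G c t}) \<le> 8 * ln (real n) / (\<nu>1 * \<rho> ^ Suc h)\<^sup>2 + 1
        + (\<Sum>t=1..n. of_bool (dev c t))"
      using optimistic_rounds_count[OF boundary_node_props(2)[OF c] _ n] boundary_node_props[OF c]
      by (simp add: G_def)
    then show "(\<Sum>t=1..n. of_bool (G c t)) \<le> 8 * ln (real n) / (\<nu>1 * \<rho> ^ Suc h)\<^sup>2 + 1
        + (\<Sum>t=1..n. of_bool (dev c t))"
      by (simp add: Int_def)
  qed (use \<nu>1_pos \<rho>_pos in auto)
  finally show ?thesis by simp
qed

end

section \<open>Concentration of empirical means\<close>

text \<open>The left side is the moment generating function at \<open>z\<close> of a centred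
  Bernoulli variable with parameter \<open>p\<close>, so this is Hoeffding's lemma for two-point
  laws. For negative \<open>z\<close>, exchanging the two outcomes replaces \<open>(z, p)\<close> by
  \<open>(- z, 1 - p)\<close>.\<close>

lemma exp_two_point_le:
  fixes p z :: real
  assumes p: "0 \<le> p" "p \<le> 1"
  shows "exp (- (z * p)) * (1 + p * (exp z - 1)) \<le> exp (z\<^sup>2 / 8)"
proof -
  have pos: "exp (- (h * q)) * (1 + q * (exp h - 1)) \<le> exp (h\<^sup>2 / 8)" if "h \<ge> 0" "q \<ge> 0" for h q :: real
  proof -
    have "q * (exp h - 1) \<ge> 0" using that by (intro mult_nonneg_nonneg) auto
    then have "1 + q * (exp h - 1) > 0" by linarith
    then have "exp (- (h * q)) * (1 + q * (exp h - 1)) = exp (- h * q + ln (1 + q * (exp h - 1)))"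
      by (simp only: exp_add exp_ln) simp
    also have "\<dots> \<le> exp (h\<^sup>2 / 8)"
      using Hoeffdings_lemma_aux[OF that] by simp
    finally show ?thesis .
  qed
  show ?thesis
  proof (cases "z \<ge> 0")
    case True
    then show ?thesis using pos p by simp
  next
    case False
    have "exp z * exp (- z) = 1"
      by (simp flip: exp_add)
    then have "exp z * (1 + (1 - p) * (exp (- z) - 1)) = 1 + p * (exp z - 1)"
      by algebra
    moreover have "exp (- (- z * (1 - p))) = exp (- (z * p)) * exp z"
      by (simp add: algebra_simps flip: exp_add)
    ultimately have "exp (- (z * p)) * (1 + p * (exp z - 1))
        = exp (- (- z * (1 - p))) * (1 + (1 - p) * (exp (- z) - 1))"
      by simp
    also have "\<dots> \<le> exp ((- z)\<^sup>2 / 8)"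
      using False p by (intro pos) auto
    finally show ?thesis by simp
  qed
qed

text \<open>The law of the reward is given on events only; averages of the indicators of
  \<open>{j / N..}\<close> carry it over to the conditional mean.\<close>

definition unit_staircase :: "nat \<Rightarrow> real \<Rightarrow> real" where
  "unit_staircase N z = (\<Sum>j=1..N. indicator {real j / real N..} z) / real N"

text \<open>On the unit interval the staircase equals \<open>floor (N * z) / N\<close>: exactly the
  thresholds \<open>j / N\<close> with \<open>j \<le> N * z\<close> contribute.\<close>

lemma unit_staircase_approx:
  assumes N: "N > 0" and z: "0 \<le> z" "z \<le> 1"
  shows "\<bar>z - unit_staircase N z\<bar> \<le> 1 / real N"
proof -
  define m where "m = nat \<lfloor>real N * z\<rfloor>"
  have Nz: "0 \<le> real N * z" "real N * z \<le> real N"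
    using z by (auto simp: mult_left_le)
  have m: "real m \<le> real N * z" "real N * z < real m + 1"
    using Nz by (auto simp: m_def)
  have "{j\<in>{1..N}. real j / real N \<le> z} = {1..m}"
  proof (intro set_eqI)
    fix j
    have "real j / real N \<le> z \<longleftrightarrow> real j \<le> real N * z"
      using N by (simp add: field_simps)
    also have "\<dots> \<longleftrightarrow> j \<le> m"
      using m by linarith
    finally show "j \<in> {j\<in>{1..N}. real j / real N \<le> z} \<longleftrightarrow> j \<in> {1..m}"
      using m Nz by auto
  qed
  moreover have "(\<Sum>j=1..N. indicator {real j / real N..} z) = real (card {j\<in>{1..N}. real j / real N \<le> z})"
    by (simp add: indicator_def Int_def flip: of_bool_def)
  ultimately have "unit_staircase N z = real m / real N"
    by (simp add: unit_staircase_def)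
  moreover have "\<bar>real N * z - real m\<bar> \<le> 1" using m by linarith
  then have "\<bar>real N * z - real m\<bar> / real N \<le> 1 / real N" by (intro divide_right_mono) auto
  moreover have "\<bar>real N * z - real m\<bar> / real N = \<bar>z - real m / real N\<bar>"
    using N by (simp add: field_simps abs_divide[symmetric] flip: abs_of_pos)
  ultimately show ?thesis by simp
qed

lemma unit_staircase_measurable [measurable]: "unit_staircase N \<in> borel_measurable borel"
  unfolding unit_staircase_def by measurable

lemma eq_if_abs_diff_le_over_nat:
  fixes a b c :: real
  assumes "\<And>N :: nat. N > 0 \<Longrightarrow> \<bar>a - b\<bar> \<le> c / real N"
  shows "a = b"
proof (rule ccontr)
  assume "a \<noteq> b"
  then have "\<bar>a - b\<bar> > 0" by simp
  then obtain N :: nat where N: "c < real N * \<bar>a - b\<bar>" using reals_Archimedean3 by blast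
  have "\<bar>a - b\<bar> \<le> c / real (Suc N)" by (rule assms) simp
  then have "real (Suc N) * \<bar>a - b\<bar> \<le> c" by (simp add: field_simps)
  with N show False by (simp add: algebra_simps)
qed

section \<open>Conditional mean of the rewards\<close>

locale ld_hoo_bandit = ld_hoo_run M F A K P \<nu>1 \<rho> H node X Y
  for M :: "'w measure" and F :: "nat \<Rightarrow> 'w measure" and A :: "'a measure"
    and K :: "'a \<Rightarrow> real measure" and P \<nu>1 \<rho> H node X Y +
  fixes f :: "'a \<Rightarrow> real"
  assumes env: "bandit_env A K f"
begin

lemma kernel_measurable [measurable]: "K \<in> A \<rightarrow>\<^sub>M prob_algebra borel"
  using env by (simp add: bandit_env_def)

lemma kernel_prob_space: "x \<in> space A \<Longrightarrow> prob_space (K x) \<and> sets (K x) = sets borel"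
  using measurable_space[OF kernel_measurable] by (auto simp: space_prob_algebra)

lemma kernel_unit: "x \<in> space A \<Longrightarrow> AE y in K x. 0 \<le> y \<and> y \<le> 1"
  using env by (auto simp: bandit_env_def)

lemma f_eq: "x \<in> space A \<Longrightarrow> f x = (LINT y|K x. y)"
  using env by (simp add: bandit_env_def)

lemma kernel_integrable: "x \<in> space A \<Longrightarrow> integrable (K x) (\<lambda>y. y)"
proof -
  assume x: "x \<in> space A"
  interpret K: prob_space "K x" using kernel_prob_space[OF x] by simp
  have [measurable_cong]: "sets (K x) = sets borel" using kernel_prob_space[OF x] by simp
  show ?thesis
    by (rule K.integrable_const_bound[of _ 1]) (use kernel_unit[OF x] in auto)
qed

lemma f_unit: "x \<in> space A \<Longrightarrow> 0 \<le> f x \<and> f x \<le> 1"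
proof -
  assume x: "x \<in> space A"
  interpret K: prob_space "K x" using kernel_prob_space[OF x] by simp
  show ?thesis
    unfolding f_eq[OF x] using kernel_unit[OF x] kernel_integrable[OF x]
    by (intro conjI K.integral_ge_const K.integral_le_const) auto
qed

lemma f_measurable [measurable]: "f \<in> borel_measurable A"
proof -
  have "(\<lambda>x. LINT y|K x. y) \<in> borel_measurable A"
    by (rule measurable_compose[OF measurable_prob_algebraD[OF kernel_measurable]
          integral_measurable_subprob_algebra]) simp
  then show ?thesis by (simp add: f_eq cong: measurable_cong)
qed

text \<open>The average of the tail probabilities is the integral of the staircase under
  \<open>K x\<close>, and on the unit interval, where \<open>K x\<close> is concentrated, the
  staircase is uniformly within \<open>1 / N\<close> of the identity.\<close>

lemma kernel_staircase:
  assumes x: "x \<in> space A" and N: "N > 0"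
  shows "\<bar>f x - (\<Sum>j=1..N. measure (K x) {real j / real N..}) / real N\<bar> \<le> 1 / real N"
proof -
  interpret K: prob_space "K x" using kernel_prob_space[OF x] by simp
  have [measurable_cong]: "sets (K x) = sets borel" using kernel_prob_space[OF x] by simp
  have "(\<Sum>j=1..N. measure (K x) {real j / real N..}) / real N = (LINT y|K x. unit_staircase N y)"
    by (simp add: unit_staircase_def kernel_prob_space[OF x] K.emeasure_eq_measure
        sets_eq_imp_space_eq[of "K x" borel])
  moreover have int: "integrable (K x) (unit_staircase N)"
    unfolding unit_staircase_def
    by (intro integrable_divide Bochner_Integration.integrable_sum integrable_real_indicator)
       (auto simp: kernel_prob_space[OF x] K.emeasure_eq_measure)
  ultimately have "f x - (\<Sum>j=1..N. measure (K x) {real j / real N..}) / real N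
      = (LINT y|K x. y - unit_staircase N y)"
    using kernel_integrable[OF x] by (simp add: f_eq[OF x])
  also have "\<bar>\<dots>\<bar> \<le> (LINT y|K x. \<bar>y - unit_staircase N y\<bar>)"
    by (rule integral_abs_bound)
  also have "\<dots> \<le> 1 / real N"
  proof (rule K.integral_le_const)
    show "integrable (K x) (\<lambda>y. \<bar>y - unit_staircase N y\<bar>)"
      using int kernel_integrable[OF x] by simp
    show "AE y in K x. \<bar>y - unit_staircase N y\<bar> \<le> 1 / real N"
      using kernel_unit[OF x] by eventually_elim (simp add: unit_staircase_approx[OF N])
  qed
  finally show ?thesis .
qed

lemma F_borel_measurable: "g \<in> borel_measurable (F t) \<Longrightarrow> g \<in> borel_measurable M"
  for g :: "'w \<Rightarrow> real"
  using measurable_from_subalg[OF F_subalgebra] .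

lemma F_measurable_mono: "s \<le> t \<Longrightarrow> g \<in> F s \<rightarrow>\<^sub>M N \<Longrightarrow> g \<in> F t \<rightarrow>\<^sub>M N"
  by (rule measurable_from_subalg[of "F t" "F s"])
     (auto simp: subalgebra_def space_F sets_F_mono)

lemma X_in_space: "t \<ge> 1 \<Longrightarrow> \<omega> \<in> space M \<Longrightarrow> X t \<omega> \<in> space A"
  using measurable_space[OF X_measurable] by (simp add: space_F)

lemma Y_measurable_M [measurable]: "t \<ge> 1 \<Longrightarrow> Y t \<in> borel_measurable M"
  by (rule F_borel_measurable[OF Y_measurable])

lemma mean_measurable: "t \<ge> 1 \<Longrightarrow> (\<lambda>\<omega>. f (X t \<omega>)) \<in> borel_measurable (F t)"
  using measurable_compose[OF X_measurable f_measurable] .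

lemma measure_kernel_measurable:
  assumes "t \<ge> 1" "B \<in> sets borel"
  shows "(\<lambda>\<omega>. measure (K (X t \<omega>)) B) \<in> borel_measurable (F t)"
proof -
  have "(\<lambda>\<omega>. K (X t \<omega>)) \<in> F t \<rightarrow>\<^sub>M prob_algebra borel"
    using measurable_compose[OF X_measurable[OF assms(1)] kernel_measurable] .
  from measurable_compose[OF this measurable_measure_prob_algebra[OF assms(2)]]
  show ?thesis .
qed

text \<open>The characteristic property of conditional expectation, tested against a weight
  \<open>G\<close> that is known when the reward is drawn. All later uses of the reward law go
  through such weights.\<close>

lemma integral_reward_indicator:
  assumes t: "t \<ge> 1" and B: "B \<in> sets borel"
    and G: "G \<in> borel_measurable (F t)" "integrable M G"
  shows "(LINT \<omega>|M. G \<omega> * indicator B (Y t \<omega>)) = (LINT \<omega>|M. G \<omega> * measure (K (X t \<omega>)) B)"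
proof -
  interpret finite_measure_subalgebra M "F t"
    by unfold_locales (rule F_subalgebra)
  have [measurable]: "Y t \<in> borel_measurable M" "B \<in> sets borel" using t B by auto
  have [measurable]: "G \<in> borel_measurable M" using G by simp
  have int: "integrable M (\<lambda>\<omega>. G \<omega> * indicator B (Y t \<omega>))"
    by (rule Bochner_Integration.integrable_bound[OF G(2)]) (auto simp: indicator_def)
  have [measurable]: "(\<lambda>\<omega>. measure (K (X t \<omega>)) B) \<in> borel_measurable M"
    using measure_kernel_measurable[OF t B] F_borel_measurable by blast
  have "(LINT \<omega>|M. G \<omega> * indicator B (Y t \<omega>))
      = (LINT \<omega>|M. G \<omega> * real_cond_exp M (F t) (\<lambda>\<omega>'. indicator B (Y t \<omega>')) \<omega>)"
    by (rule real_cond_exp_intg(2)[symmetric, OF int G(1)]) measurable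
  also have "\<dots> = (LINT \<omega>|M. G \<omega> * measure (K (X t \<omega>)) B)"
    using reward_law[OF t B] by (intro integral_cong_AE) (auto elim!: eventually_mono)
  finally show ?thesis .
qed

lemma reward_unit:
  assumes t: "t \<ge> 1"
  shows "AE \<omega> in M. 0 \<le> Y t \<omega> \<and> Y t \<omega> \<le> 1"
proof -
  have [measurable]: "Y t \<in> borel_measurable M" using t by simp
  have "(LINT \<omega>|M. 1 * indicator {0..1} (Y t \<omega>)) = (LINT \<omega>|M. 1 * measure (K (X t \<omega>)) {0..1})"
    by (rule integral_reward_indicator[OF t]) auto
  also have "\<dots> = (LINT \<omega>|M. 1)"
  proof (intro Bochner_Integration.integral_cong refl)
    fix \<omega> assume \<omega>: "\<omega> \<in> space M"
    have x: "X t \<omega> \<in> space A" by (rule X_in_space[OF t \<omega>])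
    interpret K: prob_space "K (X t \<omega>)" using kernel_prob_space[OF x] by simp
    have "measure (K (X t \<omega>)) {0..1} = 1"
      using kernel_unit[OF x] kernel_prob_space[OF x] by (subst K.prob_eq_1) auto
    then show "1 * measure (K (X t \<omega>)) {0..1} = 1" by simp
  qed
  finally have "(LINT \<omega>|M. indicator (Y t -` {0..1} \<inter> space M) \<omega>) = (1::real)"
    by (simp add: prob_space indicator_def cong: Bochner_Integration.integral_cong)
  then have "prob (Y t -` {0..1} \<inter> space M) = 1"
    by simp
  then show ?thesis
    by (subst (asm) prob_eq_1) (auto elim!: eventually_mono)
qed

text \<open>This is \<open>E[Y t | F t] = f (X t)\<close> in integrated form. Staircases replace
  \<open>Y t\<close> and \<open>f (X t)\<close> by finite sums to which the reward law applies event
  by event, at a cost of \<open>1 / N\<close> on each side.\<close>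

lemma integral_reward:
  assumes t: "t \<ge> 1" and G: "G \<in> borel_measurable (F t)" "integrable M G"
  shows "integrable M (\<lambda>\<omega>. G \<omega> * Y t \<omega>)" "integrable M (\<lambda>\<omega>. G \<omega> * f (X t \<omega>))"
    "(LINT \<omega>|M. G \<omega> * Y t \<omega>) = (LINT \<omega>|M. G \<omega> * f (X t \<omega>))"
proof -
  have [measurable]: "Y t \<in> borel_measurable M" using t by simp
  have [measurable]: "G \<in> borel_measurable M" using G by simp
  have [measurable]: "(\<lambda>\<omega>. f (X t \<omega>)) \<in> borel_measurable M"
    using mean_measurable[OF t] F_borel_measurable by blast
  show intY: "integrable M (\<lambda>\<omega>. G \<omega> * Y t \<omega>)"
  proof (rule Bochner_Integration.integrable_bound[OF G(2)])
    show "AE \<omega> in M. norm (G \<omega> * Y t \<omega>) \<le> norm (G \<omega>)"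
      using reward_unit[OF t] by eventually_elim (simp add: abs_mult mult_left_le)
  qed measurable
  show intf: "integrable M (\<lambda>\<omega>. G \<omega> * f (X t \<omega>))"
    by (rule Bochner_Integration.integrable_bound[OF G(2)])
       (use f_unit X_in_space[OF t] in \<open>auto simp: abs_mult mult_left_le\<close>)
  show "(LINT \<omega>|M. G \<omega> * Y t \<omega>) = (LINT \<omega>|M. G \<omega> * f (X t \<omega>))"
  proof (rule eq_if_abs_diff_le_over_nat)
    fix N :: nat assume N: "N > 0"
    define k where "k \<omega> = (\<Sum>j=1..N. measure (K (X t \<omega>)) {real j / real N..}) / real N" for \<omega>
    have mK: "(\<lambda>\<omega>. measure (K (X t \<omega>)) {real j / real N..}) \<in> borel_measurable M" for j
      by (rule F_borel_measurable[OF measure_kernel_measurable[OF t]]) simp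
    have intI: "integrable M (\<lambda>\<omega>. G \<omega> * indicator {real j / real N..} (Y t \<omega>))" for j
      by (rule Bochner_Integration.integrable_bound[OF G(2)]) (auto simp: indicator_def)
    have intK: "integrable M (\<lambda>\<omega>. G \<omega> * measure (K (X t \<omega>)) {real j / real N..})" for j
    proof (rule Bochner_Integration.integrable_bound[OF G(2)])
      show "(\<lambda>\<omega>. G \<omega> * measure (K (X t \<omega>)) {real j / real N..}) \<in> borel_measurable M"
        using mK by measurable
      show "AE \<omega> in M. norm (G \<omega> * measure (K (X t \<omega>)) {real j / real N..}) \<le> norm (G \<omega>)"
      proof (rule AE_I2)
        fix \<omega> assume "\<omega> \<in> space M"
        then interpret K: prob_space "K (X t \<omega>)"
          using kernel_prob_space[OF X_in_space[OF t]] by simp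
        show "norm (G \<omega> * measure (K (X t \<omega>)) {real j / real N..}) \<le> norm (G \<omega>)"
          by (simp add: abs_mult mult_left_le)
      qed
    qed
    have sY: "G \<omega> * unit_staircase N (Y t \<omega>)
        = (\<Sum>j=1..N. G \<omega> * indicator {real j / real N..} (Y t \<omega>)) / real N" for \<omega>
      by (simp add: unit_staircase_def sum_distrib_left)
    have sK: "G \<omega> * k \<omega> = (\<Sum>j=1..N. G \<omega> * measure (K (X t \<omega>)) {real j / real N..}) / real N" for \<omega>
      by (simp add: k_def sum_distrib_left)
    have int_sY: "integrable M (\<lambda>\<omega>. G \<omega> * unit_staircase N (Y t \<omega>))"
      unfolding sY by (intro integrable_divide Bochner_Integration.integrable_sum intI)
    have int_sK: "integrable M (\<lambda>\<omega>. G \<omega> * k \<omega>)"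
      unfolding sK by (intro integrable_divide Bochner_Integration.integrable_sum intK)
    have eq: "(LINT \<omega>|M. G \<omega> * unit_staircase N (Y t \<omega>)) = (LINT \<omega>|M. G \<omega> * k \<omega>)"
    proof -
      have "(LINT \<omega>|M. G \<omega> * indicator {real j / real N..} (Y t \<omega>))
          = (LINT \<omega>|M. G \<omega> * measure (K (X t \<omega>)) {real j / real N..})" for j
        by (rule integral_reward_indicator[OF t _ G]) simp
      then show ?thesis
        unfolding sY sK
        by (simp only: integral_divide_zero Bochner_Integration.integral_sum intI intK)
    qed
    \<comment> \<open>\<open>E\<close> collects the two discretisation errors, of the reward and of
      its mean. The staircase terms have equal expectations by \<open>eq\<close>, so the expectation
      of \<open>E\<close> is the difference sought.\<close>
    define E where "E \<omega> = (G \<omega> * Y t \<omega> - G \<omega> * unit_staircase N (Y t \<omega>)) + (G \<omega> * k \<omega> - G \<omega> * f (X t \<omega>))"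
      for \<omega>
    have int_E: "integrable M E"
      unfolding E_def[abs_def] using intY intf int_sY int_sK by simp
    have "(LINT \<omega>|M. G \<omega> * Y t \<omega>) - (LINT \<omega>|M. G \<omega> * f (X t \<omega>)) = (LINT \<omega>|M. E \<omega>)"
      unfolding E_def using intY intf int_sY int_sK eq by simp
    then have "\<bar>(LINT \<omega>|M. G \<omega> * Y t \<omega>) - (LINT \<omega>|M. G \<omega> * f (X t \<omega>))\<bar> \<le> (LINT \<omega>|M. \<bar>E \<omega>\<bar>)"
      using integral_abs_bound[of M E] by simp
    also have "\<dots> \<le> (LINT \<omega>|M. 2 / real N * \<bar>G \<omega>\<bar>)"
    proof (rule integral_mono_AE)
      show "AE \<omega> in M. \<bar>E \<omega>\<bar> \<le> 2 / real N * \<bar>G \<omega>\<bar>"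
        using reward_unit[OF t] AE_space
      proof eventually_elim
        case (elim \<omega>)
        have "\<bar>Y t \<omega> - unit_staircase N (Y t \<omega>)\<bar> \<le> 1 / real N"
          using elim by (intro unit_staircase_approx N) auto
        moreover have "\<bar>f (X t \<omega>) - k \<omega>\<bar> \<le> 1 / real N"
          unfolding k_def using elim by (intro kernel_staircase X_in_space t N) auto
        ultimately have "\<bar>(Y t \<omega> - unit_staircase N (Y t \<omega>)) + (k \<omega> - f (X t \<omega>))\<bar> \<le> 2 / real N"
          by (simp add: abs_if split: if_splits)
        then have "\<bar>G \<omega>\<bar> * \<bar>(Y t \<omega> - unit_staircase N (Y t \<omega>)) + (k \<omega> - f (X t \<omega>))\<bar> \<le> \<bar>G \<omega>\<bar> * (2 / real N)"
          by (intro mult_left_mono) auto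
        then show ?case by (simp add: E_def abs_mult[symmetric] algebra_simps)
      qed
    qed (use int_E G in auto)
    also have "\<dots> = 2 * (LINT \<omega>|M. \<bar>G \<omega>\<bar>) / real N" by simp
    finally show "\<bar>(LINT \<omega>|M. G \<omega> * Y t \<omega>) - (LINT \<omega>|M. G \<omega> * f (X t \<omega>))\<bar>
        \<le> 2 * (LINT \<omega>|M. \<bar>G \<omega>\<bar>) / real N" .
  qed
qed

section \<open>The exponential supermartingale of the noise\<close>

definition hit :: "Defs.node \<Rightarrow> nat \<Rightarrow> 'w \<Rightarrow> real" where
  "hit v t \<omega> = of_bool (node t \<omega> \<in> descendants v)"

definition hits :: "Defs.node \<Rightarrow> nat \<Rightarrow> 'w \<Rightarrow> real" where
  "hits v t \<omega> = (\<Sum>\<tau>=1..t. hit v \<tau> \<omega>)"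

text \<open>The sum runs over all rounds with indicator weights rather than over the random set of
  visits, which makes measurability and one-step increments immediate.\<close>

definition noise :: "Defs.node \<Rightarrow> nat \<Rightarrow> 'w \<Rightarrow> real" where
  "noise v t \<omega> = (\<Sum>\<tau>=1..t. hit v \<tau> \<omega> * (Y \<tau> \<omega> - f (X \<tau> \<omega>)))"

definition hoeffding_process :: "Defs.node \<Rightarrow> real \<Rightarrow> nat \<Rightarrow> 'w \<Rightarrow> real" where
  "hoeffding_process v z t \<omega> = exp (z * noise v t \<omega> - z\<^sup>2 / 8 * hits v t \<omega>)"

lemma hits_eq: "hits v t \<omega> = real (visit_count (\<lambda>s. node s \<omega>) v t)"
  by (simp add: hits_def hit_def visit_count_def visits_def Int_def)

lemma noise_eq: "noise v t \<omega> = reward_noise f (\<lambda>s. node s \<omega>) (\<lambda>s. X s \<omega>) (\<lambda>s. Y s \<omega>) v t"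
proof -
  have "noise v t \<omega> = (\<Sum>\<tau>=1..t. if node \<tau> \<omega> \<in> descendants v then Y \<tau> \<omega> - f (X \<tau> \<omega>) else 0)"
    unfolding noise_def hit_def by (intro sum.cong) auto
  also have "\<dots> = (\<Sum>\<tau>\<in>{\<tau>\<in>{1..t}. node \<tau> \<omega> \<in> descendants v}. Y \<tau> \<omega> - f (X \<tau> \<omega>))"
    by (rule sum.inter_filter[symmetric]) simp
  finally show ?thesis by (simp only: reward_noise_def visits_def)
qed

lemma hit_measurable: "t \<ge> 1 \<Longrightarrow> hit v t \<in> borel_measurable (F t)"
  using measurable_compose[OF node_measurable, of t "\<lambda>w. of_bool (w \<in> descendants v)" borel]
  by (simp add: hit_def[abs_def])

lemma hits_measurable: "hits v t \<in> borel_measurable (F (Suc t))"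
  unfolding hits_def[abs_def]
  by (intro borel_measurable_sum F_measurable_mono[OF _ hit_measurable]) auto

text \<open>The reward of round \<open>t\<close> is known only from \<open>F (Suc t)\<close> on,
  hence the shifted index.\<close>

lemma noise_measurable: "noise v t \<in> borel_measurable (F (Suc t))"
  unfolding noise_def[abs_def]
  by (intro borel_measurable_sum borel_measurable_times borel_measurable_diff
      F_measurable_mono[OF _ hit_measurable] F_measurable_mono[OF _ mean_measurable]
      F_measurable_mono[OF _ Y_measurable]) auto

lemma hoeffding_process_measurable: "hoeffding_process v z t \<in> borel_measurable (F (Suc t))"
proof -
  have [measurable]: "noise v t \<in> borel_measurable (F (Suc t))"
    "hits v t \<in> borel_measurable (F (Suc t))"
    using noise_measurable hits_measurable by auto
  show ?thesis unfolding hoeffding_process_def[abs_def] by measurable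
qed

lemma noise_bounded: "AE \<omega> in M. \<bar>noise v t \<omega>\<bar> \<le> real t"
proof -
  have "AE \<omega> in M. \<forall>\<tau>\<in>{1..t}. 0 \<le> Y \<tau> \<omega> \<and> Y \<tau> \<omega> \<le> 1"
    using reward_unit by (intro AE_finite_allI) auto
  then show ?thesis
    using AE_space
  proof eventually_elim
    case (elim \<omega>)
    have "\<bar>noise v t \<omega>\<bar> \<le> (\<Sum>\<tau>=1..t. \<bar>hit v \<tau> \<omega> * (Y \<tau> \<omega> - f (X \<tau> \<omega>))\<bar>)"
      unfolding noise_def by (rule sum_abs)
    also have "\<dots> \<le> (\<Sum>\<tau>=1..t. 1)"
    proof (intro sum_mono)
      fix \<tau> assume \<tau>: "\<tau> \<in> {1..t}"
      have "0 \<le> f (X \<tau> \<omega>) \<and> f (X \<tau> \<omega>) \<le> 1"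
        using f_unit X_in_space[of \<tau> \<omega>] \<tau> elim by auto
      moreover have "0 \<le> Y \<tau> \<omega> \<and> Y \<tau> \<omega> \<le> 1" using elim \<tau> by auto
      ultimately show "\<bar>hit v \<tau> \<omega> * (Y \<tau> \<omega> - f (X \<tau> \<omega>))\<bar> \<le> 1"
        by (auto simp: hit_def)
    qed
    finally show ?case by simp
  qed
qed

lemma hoeffding_process_integrable: "integrable M (hoeffding_process v z t)"
proof (rule integrable_const_bound[of _ "exp (\<bar>z\<bar> * real t)"])
  show "hoeffding_process v z t \<in> borel_measurable M"
    using hoeffding_process_measurable F_borel_measurable by blast
  show "AE \<omega> in M. norm (hoeffding_process v z t \<omega>) \<le> exp (\<bar>z\<bar> * real t)"
    using noise_bounded[of v t]
  proof eventually_elim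
    case (elim \<omega>)
    have "z * noise v t \<omega> \<le> \<bar>z\<bar> * \<bar>noise v t \<omega>\<bar>"
      by (metis abs_ge_self abs_mult)
    also have "\<dots> \<le> \<bar>z\<bar> * real t" using elim by (intro mult_left_mono) auto
    finally have "z * noise v t \<omega> \<le> \<bar>z\<bar> * real t" .
    moreover have "0 \<le> z\<^sup>2 / 8 * hits v t \<omega>" by (simp add: hits_eq)
    ultimately show ?case by (simp add: hoeffding_process_def)
  qed
qed

text \<open>Convexity of the exponential on \<open>[0, 1]\<close> makes the conditional form of Hoeffding's lemma
  depend on the reward only through its conditional mean.\<close>

lemma hoeffding_process_step:
  "(LINT \<omega>|M. hoeffding_process v z (Suc t) \<omega>) \<le> (LINT \<omega>|M. hoeffding_process v z t \<omega>)"
proof -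
  define W where "W = hoeffding_process v z t"
  define I where "I = hit v (Suc t)"
  define p where "p \<omega> = f (X (Suc t) \<omega>)" for \<omega>
  \<comment> \<open>\<open>g\<close> carries the centring and the compensation of one visit. As a
    function of the reward \<open>y\<close>, \<open>a + b * y\<close> is the affine majorant of the
    one-step factor; it equals \<open>1\<close> when the node is not hit.\<close>
  define g where "g \<omega> = exp (- (z * p \<omega>)) * exp (- (z\<^sup>2 / 8))" for \<omega>
  define a where "a \<omega> = 1 - I \<omega> + I \<omega> * g \<omega>" for \<omega>
  define b where "b \<omega> = I \<omega> * g \<omega> * (exp z - 1)" for \<omega>
  have t: "Suc t \<ge> 1" by simp
  have [measurable]: "W \<in> borel_measurable (F (Suc t))" "I \<in> borel_measurable (F (Suc t))"
    "p \<in> borel_measurable (F (Suc t))"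
    using hoeffding_process_measurable hit_measurable[OF t] mean_measurable[OF t]
    by (auto simp: W_def I_def p_def[abs_def])
  have [measurable]: "a \<in> borel_measurable (F (Suc t))" "b \<in> borel_measurable (F (Suc t))"
    unfolding a_def[abs_def] b_def[abs_def] g_def[abs_def] by measurable
  have intW: "integrable M W" by (simp add: W_def hoeffding_process_integrable)
  have W0: "W \<omega> > 0" for \<omega> by (simp add: W_def hoeffding_process_def)
  have I01: "I \<omega> = 0 \<or> I \<omega> = 1" for \<omega> by (simp add: I_def hit_def)
  have p01: "0 \<le> p \<omega> \<and> p \<omega> \<le> 1" if "\<omega> \<in> space M" for \<omega>
    using f_unit X_in_space[OF t that] by (simp add: p_def)
  have g: "0 < g \<omega> \<and> g \<omega> \<le> exp \<bar>z\<bar>" if "\<omega> \<in> space M" for \<omega>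
  proof -
    have "- (z * p \<omega>) \<le> \<bar>z\<bar> * p \<omega>"
      using p01[OF that] by (metis abs_ge_minus_self minus_mult_left mult_right_mono)
    also have "\<dots> \<le> \<bar>z\<bar>" using p01[OF that] by (simp add: mult_left_le)
    finally have "- (z * p \<omega>) - z\<^sup>2 / 8 \<le> \<bar>z\<bar>"
      using zero_le_power2[of z] by linarith
    then show ?thesis by (simp add: g_def flip: exp_add)
  qed
  have bounded_int: "integrable M (\<lambda>\<omega>. W \<omega> * h \<omega>)"
    if "h \<in> borel_measurable (F (Suc t))" "\<And>\<omega>. \<omega> \<in> space M \<Longrightarrow> \<bar>h \<omega>\<bar> \<le> C" for h C
  proof (rule Bochner_Integration.integrable_bound[of _ "\<lambda>\<omega>. C * W \<omega>"])
    show "integrable M (\<lambda>\<omega>. C * W \<omega>)" using intW by simp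
    show "(\<lambda>\<omega>. W \<omega> * h \<omega>) \<in> borel_measurable M"
      using that(1) by (intro F_borel_measurable[of _ "Suc t"]) measurable
    show "AE \<omega> in M. norm (W \<omega> * h \<omega>) \<le> norm (C * W \<omega>)"
    proof (rule AE_I2)
      fix \<omega> assume "\<omega> \<in> space M"
      then have "\<bar>h \<omega>\<bar> \<le> \<bar>C\<bar>" using that(2)[of \<omega>] by linarith
      then show "norm (W \<omega> * h \<omega>) \<le> norm (C * W \<omega>)"
        using W0[of \<omega>] by (simp add: abs_mult mult.commute mult_right_mono)
    qed
  qed
  have int_a: "integrable M (\<lambda>\<omega>. W \<omega> * a \<omega>)"
  proof (rule bounded_int)
    show "\<bar>a \<omega>\<bar> \<le> 1 + exp \<bar>z\<bar>" if "\<omega> \<in> space M" for \<omega>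
      using g[OF that] I01[of \<omega>] by (auto simp: a_def)
  qed measurable
  have int_b: "integrable M (\<lambda>\<omega>. W \<omega> * b \<omega>)"
  proof (rule bounded_int)
    show "\<bar>b \<omega>\<bar> \<le> exp \<bar>z\<bar> * \<bar>exp z - 1\<bar>" if "\<omega> \<in> space M" for \<omega>
      using g[OF that] I01[of \<omega>] by (auto simp: b_def abs_mult mult_right_mono)
  qed measurable
  have meas_b: "(\<lambda>\<omega>. W \<omega> * b \<omega>) \<in> borel_measurable (F (Suc t))" by measurable
  \<comment> \<open>\<open>W * b\<close> is known before the reward is drawn, so it can serve as
    weight, and the reward may be replaced by its mean \<open>p\<close> in the integral.\<close>
  note rew = integral_reward[OF t meas_b int_b]
  have "(LINT \<omega>|M. hoeffding_process v z (Suc t) \<omega>)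
      \<le> (LINT \<omega>|M. W \<omega> * a \<omega> + W \<omega> * b \<omega> * Y (Suc t) \<omega>)"
  proof (rule integral_mono_AE)
    show "AE \<omega> in M. hoeffding_process v z (Suc t) \<omega> \<le> W \<omega> * a \<omega> + W \<omega> * b \<omega> * Y (Suc t) \<omega>"
      using reward_unit[OF t]
    proof eventually_elim
      case (elim \<omega>)
      define y where "y = Y (Suc t) \<omega>"
      have "convex_on UNIV (exp :: real \<Rightarrow> real)"
        by (intro convex_on_realI[where f' = exp]) (auto intro!: derivative_eq_intros)
      from convex_onD[OF this, of y 0 z] have "exp (y * z) \<le> (1 - y) + y * exp z"
        using elim by (simp add: y_def)
      then have "exp (z * y) \<le> 1 + (exp z - 1) * y" by (simp add: algebra_simps)
      then have "exp (z * y) * g \<omega> \<le> (1 + (exp z - 1) * y) * g \<omega>"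
        by (intro mult_right_mono) (simp_all add: g_def)
      moreover have "exp (z * y) * g \<omega> = exp (z * (y - p \<omega>) - z\<^sup>2 / 8)"
        by (simp add: g_def algebra_simps flip: exp_add)
      moreover have "hoeffding_process v z (Suc t) \<omega>
          = W \<omega> * exp (z * (I \<omega> * (y - p \<omega>)) - z\<^sup>2 / 8 * I \<omega>)"
        by (simp add: hoeffding_process_def W_def noise_def hits_def I_def p_def y_def
            algebra_simps flip: exp_add)
      moreover have "exp (z * (I \<omega> * (y - p \<omega>)) - z\<^sup>2 / 8 * I \<omega>) \<le> a \<omega> + b \<omega> * y"
        if "exp (z * (y - p \<omega>) - z\<^sup>2 / 8) \<le> (1 + (exp z - 1) * y) * g \<omega>"
        using that I01[of \<omega>] by (auto simp: a_def b_def algebra_simps)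
      ultimately have "hoeffding_process v z (Suc t) \<omega> \<le> W \<omega> * (a \<omega> + b \<omega> * y)"
        using W0[of \<omega>] by (simp add: mult_left_mono)
      then show ?case by (simp add: y_def algebra_simps)
    qed
  qed (use int_a rew(1) hoeffding_process_integrable in auto)
  also have "\<dots> = (LINT \<omega>|M. W \<omega> * a \<omega> + W \<omega> * b \<omega> * p \<omega>)"
    using int_a rew by (simp add: p_def)
  also have "\<dots> \<le> (LINT \<omega>|M. W \<omega>)"
  proof (rule integral_mono)
    fix \<omega> assume \<omega>: "\<omega> \<in> space M"
    \<comment> \<open>Evaluated at the mean, the majorant is a two-point moment generating function;
      its bound \<open>exp (z\<^sup>2 / 8)\<close> is cancelled by the compensation in
      \<open>g\<close>.\<close>
    have "exp (- (z * p \<omega>)) * (1 + p \<omega> * (exp z - 1)) \<le> exp (z\<^sup>2 / 8)"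
      using p01[OF \<omega>] by (intro exp_two_point_le) auto
    then have "exp (- (z * p \<omega>)) * (1 + p \<omega> * (exp z - 1)) * exp (- (z\<^sup>2 / 8)) \<le> exp (z\<^sup>2 / 8) * exp (- (z\<^sup>2 / 8))"
      by (intro mult_right_mono) auto
    then have "g \<omega> * (1 + p \<omega> * (exp z - 1)) \<le> 1"
      by (simp add: g_def algebra_simps flip: exp_add)
    then have "a \<omega> + b \<omega> * p \<omega> \<le> 1"
      using I01[of \<omega>] by (auto simp: a_def b_def algebra_simps)
    then have "W \<omega> * (a \<omega> + b \<omega> * p \<omega>) \<le> W \<omega> * 1"
      using W0[of \<omega>] by (intro mult_left_mono) auto
    then show "W \<omega> * a \<omega> + W \<omega> * b \<omega> * p \<omega> \<le> W \<omega>" by (simp add: algebra_simps)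
  qed (use int_a rew(2) intW in \<open>auto simp: p_def\<close>)
  finally show ?thesis by (simp add: W_def)
qed

lemma integral_hoeffding_process_le: "(LINT \<omega>|M. hoeffding_process v z t \<omega>) \<le> 1"
proof (induction t)
  case 0
  show ?case by (simp add: hoeffding_process_def noise_def hits_def prob_space)
next
  case (Suc t)
  then show ?case using hoeffding_process_step[of v z t] by linarith
qed

section \<open>Deviation probabilities\<close>

definition deviation :: "Defs.node \<Rightarrow> nat \<Rightarrow> 'w \<Rightarrow> real" where
  "deviation v t \<omega> = of_bool (deviates f (\<lambda>s. node s \<omega>) (\<lambda>s. X s \<omega>) (\<lambda>s. Y s \<omega>) v t)"

lemma deviation_integrable: "integrable M (deviation v t)"
proof (rule integrable_const_bound[of _ 1])
  have [measurable]: "noise v (t - 1) \<in> borel_measurable M" "hits v (t - 1) \<in> borel_measurable M"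
    using noise_measurable hits_measurable F_borel_measurable by blast+
  have eq: "deviation v t = (\<lambda>\<omega>. of_bool (hits v (t - 1) \<omega> > 0 \<and>
      sqrt (2 * ln (real t) * hits v (t - 1) \<omega>) < \<bar>noise v (t - 1) \<omega>\<bar>))"
    by (simp add: deviation_def[abs_def] deviates_def hits_eq noise_eq)
  show "deviation v t \<in> borel_measurable M"
    unfolding eq of_bool_def by measurable
qed (simp add: deviation_def)

text \<open>On a deviation with count \<open>k\<close>, the process with parameter
  \<open>z k\<close> or \<open>- z k\<close>, according to the sign of the noise, is at least
  \<open>t ^ 4\<close>. Each process has expectation at most \<open>1\<close> and \<open>k\<close>
  ranges over \<open>t - 1\<close> values, so Markov's inequality and a union bound, both carried
  out pointwise, give \<open>2 * (t - 1) / t ^ 4\<close>.\<close>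

lemma integral_deviation_le:
  assumes t: "t \<ge> 1"
  shows "(LINT \<omega>|M. deviation v t \<omega>) \<le> 2 / real t ^ 3"
proof -
  \<comment> \<open>the minimiser of \<open>z\<^sup>2 k / 8 - z s\<close> at the threshold \<open>s = sqrt (2 k ln t)\<close>\<close>
  define z where "z k = 4 * sqrt (2 * ln (real t) / real k)" for k :: nat
  have tail: "real t ^ 4 \<le> exp (z k * s - (z k)\<^sup>2 / 8 * real k)"
    if "k \<ge> 1" "sqrt (2 * ln (real t) * real k) < s" for k s
  proof -
    have ln0: "ln (real t) \<ge> 0" using t by simp
    have "(z k)\<^sup>2 = 32 * ln (real t) / real k"
      using ln0 by (simp add: z_def power_mult_distrib)
    then have sq: "(z k)\<^sup>2 / 8 * real k = 4 * ln (real t)" using that by simp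
    have "z k * sqrt (2 * ln (real t) * real k) = 4 * sqrt ((2 * ln (real t))\<^sup>2)"
      using that by (simp add: z_def power2_eq_square flip: real_sqrt_mult)
    also have "\<dots> = 8 * ln (real t)" using ln0 by (subst real_sqrt_abs) simp
    finally have "z k * sqrt (2 * ln (real t) * real k) = 8 * ln (real t)" .
    moreover have "z k * sqrt (2 * ln (real t) * real k) \<le> z k * s"
      using that(2) ln0 by (intro mult_left_mono) (auto simp: z_def)
    ultimately have "8 * ln (real t) \<le> z k * s" by simp
    then have "exp (4 * ln (real t)) \<le> exp (z k * s - (z k)\<^sup>2 / 8 * real k)"
      using sq by simp
    moreover have "exp (4 * ln (real t)) = real t ^ 4"
      using t exp_of_nat_mult[of 4 "ln (real t)"] by simp
    ultimately show ?thesis by simp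
  qed
  define D where "D k \<omega> = hoeffding_process v (z k) (t - 1) \<omega> + hoeffding_process v (- z k) (t - 1) \<omega>"
    for k \<omega>
  have D0: "D k \<omega> \<ge> 0" for k \<omega> by (simp add: D_def hoeffding_process_def)
  have "deviation v t \<omega> \<le> (\<Sum>k=1..t-1. D k \<omega>) / real t ^ 4" for \<omega>
  proof (cases "deviation v t \<omega> = 0")
    case True
    then show ?thesis using D0 by (simp add: sum_nonneg)
  next
    case False
    define k where "k = visit_count (\<lambda>s. node s \<omega>) v (t - 1)"
    have dev: "k > 0" "sqrt (2 * ln (real t) * real k) < \<bar>noise v (t - 1) \<omega>\<bar>"
      using False by (simp_all add: deviation_def deviates_def k_def noise_eq split: if_splits)
    have "k \<le> card {1..t-1}"
      unfolding k_def visit_count_def visits_def by (intro card_mono) auto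
    then have k: "k \<in> {1..t-1}" using dev(1) by simp
    have hits: "hits v (t - 1) \<omega> = real k" by (simp add: hits_eq k_def)
    have "real t ^ 4 \<le> D k \<omega>"
    proof (cases "noise v (t - 1) \<omega> \<ge> 0")
      case True
      then have "real t ^ 4 \<le> hoeffding_process v (z k) (t - 1) \<omega>"
        using tail[of k "noise v (t - 1) \<omega>"] dev
        unfolding hoeffding_process_def hits by simp
      then show ?thesis by (simp add: D_def hoeffding_process_def add_increasing2)
    next
      case False
      then have "real t ^ 4 \<le> hoeffding_process v (- z k) (t - 1) \<omega>"
        using tail[of k "- noise v (t - 1) \<omega>"] dev
        unfolding hoeffding_process_def hits by simp
      then show ?thesis by (simp add: D_def hoeffding_process_def add_increasing)
    qed
    also have "\<dots> \<le> (\<Sum>k=1..t-1. D k \<omega>)"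
      using k D0 by (intro member_le_sum) auto
    finally have "1 \<le> (\<Sum>k=1..t-1. D k \<omega>) / real t ^ 4" using t by simp
    then show ?thesis by (simp add: deviation_def)
  qed
  then have "(LINT \<omega>|M. deviation v t \<omega>) \<le> (LINT \<omega>|M. (\<Sum>k=1..t-1. D k \<omega>) / real t ^ 4)"
    by (intro integral_mono deviation_integrable integrable_divide Bochner_Integration.integrable_sum)
       (auto simp: D_def[abs_def] hoeffding_process_integrable)
  also have "\<dots> = (\<Sum>k=1..t-1. (LINT \<omega>|M. D k \<omega>)) / real t ^ 4"
    by (simp add: D_def[abs_def] hoeffding_process_integrable)
  also have "\<dots> \<le> (\<Sum>k=1..t-1. 2) / real t ^ 4"
  proof (intro divide_right_mono sum_mono)
    fix k
    have "(LINT \<omega>|M. D k \<omega>) = (LINT \<omega>|M. hoeffding_process v (z k) (t - 1) \<omega>)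
        + (LINT \<omega>|M. hoeffding_process v (- z k) (t - 1) \<omega>)"
      by (simp add: D_def[abs_def] hoeffding_process_integrable)
    also have "\<dots> \<le> 1 + 1" by (intro add_mono integral_hoeffding_process_le)
    finally show "(LINT \<omega>|M. D k \<omega>) \<le> 2" by simp
  qed simp
  also have "\<dots> \<le> 2 * real t / real t ^ 4"
    using t by (intro divide_right_mono) auto
  also have "\<dots> = 2 / real t ^ 3"
    using t by (simp add: power4_eq_xxxx power3_eq_cube)
  finally show ?thesis .
qed

end

section \<open>Counting near-optimal nodes and summing over depths\<close>

lemma near_optimality_dim_nonneg: "0 \<le> near_optimality_dim S l f xs c e"
  unfolding near_optimality_dim_def by (auto intro: INF_greatest)

lemma sm_diam_imp_dist_le:
  assumes "sm_diam l U \<le> ereal D" "x \<in> U" "x' \<in> U"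
  shows "l x x' \<le> D"
proof -
  have "ereal (l x x') \<le> sm_diam l U"
    unfolding sm_diam_def using assms(2,3) by (intro SUP_upper2[of "(x, x')"]) auto
  then have "ereal (l x x') \<le> ereal D" using assms(1) by (rule order_trans)
  then show ?thesis by simp
qed

lemma packing_number_ge_card:
  assumes "finite I" and "\<And>i. i \<in> I \<Longrightarrow> c i \<in> U \<and> sm_ball S l (c i) e \<subseteq> U"
    and "\<And>i j. i \<in> I \<Longrightarrow> j \<in> I \<Longrightarrow> i \<noteq> j \<Longrightarrow> sm_ball S l (c i) e \<inter> sm_ball S l (c j) e = {}"
  shows "enat (card I) \<le> packing_number S l U e"
proof -
  obtain g where g: "bij_betw g {0..<card I} I"
    using ex_bij_betw_nat_finite[OF assms(1)] by blast
  have gI: "g k \<in> I" if "k < card I" for k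
    using bij_betwE[OF g] that by auto
  have inj: "g i \<noteq> g j" if "i < card I" "j < card I" "i \<noteq> j" for i j
    using bij_betw_imp_inj_on[OF g] that by (auto dest: inj_onD)
  have "(\<forall>k<card I. (c \<circ> g) k \<in> U \<and> sm_ball S l ((c \<circ> g) k) e \<subseteq> U) \<and>
      disjoint_family_on (\<lambda>k. sm_ball S l ((c \<circ> g) k) e) {..<card I}"
  proof (intro conjI)
    show "\<forall>k<card I. (c \<circ> g) k \<in> U \<and> sm_ball S l ((c \<circ> g) k) e \<subseteq> U"
      using assms(2) gI by simp
    show "disjoint_family_on (\<lambda>k. sm_ball S l ((c \<circ> g) k) e) {..<card I}"
      unfolding disjoint_family_on_def
      using assms(3)[OF gI gI inj] by simp
  qed
  then show ?thesis
    unfolding packing_number_def by (intro Sup_upper) blast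
qed

text \<open>At scale \<open>e = \<nu>2 * \<rho> ^ h\<close> the factor
  \<open>4 * \<nu>1 / \<nu>2\<close> produces \<open>4 * \<nu>1 * \<rho> ^ h\<close>, the gap bound
  in near-optimal cells of depth \<open>h\<close>. The balls inscribed in these cells are thus
  disjoint balls inside the near-optimal set, and \<open>e \<le> \<nu>2\<close> is in the range of
  the packing bound.\<close>

lemma (in weakly_lipschitz_cells) card_near_optimal_nodes_le:
  assumes wsc: "well_shaped_cells S l P \<nu>1 \<nu>2 \<rho>"
    and exponent: "packing_exponent S l f xs (4 * \<nu>1 / \<nu>2) \<nu>2 d"
  obtains \<kappa> where "\<kappa> > 0"
    "\<And>h. real (card (near_optimal_nodes h)) \<le> \<kappa> * \<rho> powr (- (real h * d))"
proof -
  have \<nu>2: "\<nu>2 > 0" using wsc by (simp add: well_shaped_cells_def)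
  obtain c where "\<forall>h. \<forall>i<2^h. c h i \<in> P h i \<and>
        sm_diam l (P h i) \<le> ereal (\<nu>1 * \<rho> ^ h) \<and>
        sm_ball S l (c h i) (\<nu>2 * \<rho> ^ h) \<subseteq> P h i \<and>
        (\<forall>j<2^h. i \<noteq> j \<longrightarrow>
           sm_ball S l (c h i) (\<nu>2 * \<rho> ^ h) \<inter> sm_ball S l (c h j) (\<nu>2 * \<rho> ^ h) = {})"
    using wsc unfolding well_shaped_cells_def by blast
  then have c: "\<And>h i. i < 2^h \<Longrightarrow> c h i \<in> P h i \<and> sm_ball S l (c h i) (\<nu>2 * \<rho> ^ h) \<subseteq> P h i"
    and disj: "\<And>h i j. i < 2^h \<Longrightarrow> j < 2^h \<Longrightarrow> i \<noteq> j \<Longrightarrow>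
      sm_ball S l (c h i) (\<nu>2 * \<rho> ^ h) \<inter> sm_ball S l (c h j) (\<nu>2 * \<rho> ^ h) = {}"
    by blast+
  obtain C where C: "C > 0" "\<And>e. 0 < e \<Longrightarrow> e \<le> \<nu>2 \<Longrightarrow>
      ereal_of_enat (packing_number S l (near_optimal_set S f xs (4 * \<nu>1 / \<nu>2 * e)) e)
        \<le> ereal (C * e powr (- d))"
    using exponent unfolding packing_exponent_def by blast
  have "real (card (near_optimal_nodes h)) \<le> C * \<nu>2 powr (- d) * \<rho> powr (- (real h * d))" for h
  proof -
    define e where "e = \<nu>2 * \<rho> ^ h"
    define U where "U = near_optimal_set S f xs (4 * \<nu>1 / \<nu>2 * e)"
    have e: "0 < e" "e \<le> \<nu>2"
      using \<nu>2 \<rho>_pos \<rho>_less_1 by (auto simp: e_def mult_left_le power_le_one)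
    have cU: "P h i \<subseteq> U" if "(h, i) \<in> near_optimal_nodes h" for i
    proof
      fix x assume x: "x \<in> P h i"
      have no: "near_optimal (h, i)" using that by (simp add: near_optimal_nodes_def)
      have "x \<in> cell (h, i)" using x by (simp add: cell_def)
      then have "f xs - f x \<le> 4 * \<nu>1 * \<rho> ^ h" "x \<in> S"
        using gap_in_near_optimal_cell[OF no] cell_subset[of "(h, i)"] no
        by (auto simp: near_optimal_def)
      then show "x \<in> U" using \<nu>2 by (simp add: U_def near_optimal_set_def e_def)
    qed
    have node: "fst v = h \<and> snd v < 2 ^ h \<and> (h, snd v) \<in> near_optimal_nodes h"
      if "v \<in> near_optimal_nodes h" for v
      using that by (auto simp: near_optimal_nodes_def near_optimal_def valid_node_def)
    have "enat (card (near_optimal_nodes h)) \<le> packing_number S l U e"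
    proof (rule packing_number_ge_card[OF finite_near_optimal_nodes, of _ "\<lambda>v. c h (snd v)"])
      show "c h (snd v) \<in> U \<and> sm_ball S l (c h (snd v)) e \<subseteq> U" if "v \<in> near_optimal_nodes h" for v
        using node[OF that] c[of "snd v" h] cU[of "snd v"] unfolding e_def by blast
      show "sm_ball S l (c h (snd v)) e \<inter> sm_ball S l (c h (snd w)) e = {}"
        if "v \<in> near_optimal_nodes h" "w \<in> near_optimal_nodes h" "v \<noteq> w" for v w
        unfolding e_def using node[OF that(1)] node[OF that(2)] that(3)
        by (intro disj) (auto simp: prod_eq_iff)
    qed
    then have "ereal_of_enat (enat (card (near_optimal_nodes h))) \<le> ereal_of_enat (packing_number S l U e)"
      by (simp only: ereal_of_enat_le_iff)
    also have "\<dots> \<le> ereal (C * e powr (- d))" unfolding U_def by (rule C(2)[OF e])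
    finally have "real (card (near_optimal_nodes h)) \<le> C * e powr (- d)" by simp
    also have "e powr (- d) = \<nu>2 powr (- d) * \<rho> powr (- (real h * d))"
      using \<nu>2 \<rho>_pos by (simp add: e_def powr_mult powr_powr flip: powr_realpow)
    finally show ?thesis by simp
  qed
  moreover have "C * \<nu>2 powr (- d) > 0" using C(1) \<nu>2 by simp
  ultimately show ?thesis using that by blast
qed

lemma sum_powr_le_max:
  fixes \<rho> a :: real
  assumes "0 < \<rho>" "\<rho> < 1" "H > 0"
  shows "(\<Sum>h<H. \<rho> powr (real h * a)) \<le> real H * max (\<rho> powr (real H * a)) (real H)"
proof -
  have "\<rho> powr (real h * a) \<le> max (\<rho> powr (real H * a)) (real H)" if "h < H" for h
  \<comment> \<open>For \<open>a \<ge> 0\<close> each term is at most \<open>1\<close>, hence at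
    most \<open>H\<close>; for negative \<open>a\<close> the terms grow with \<open>h\<close> and
    stay below the value at \<open>H\<close>. The maximum covers both cases at once.\<close>
  proof (cases "a \<ge> 0")
    case True
    then have "\<rho> powr (real h * a) \<le> \<rho> powr 0"
      using assms by (intro powr_mono') auto
    then show ?thesis using assms by simp
  next
    case False
    then have "real H * a \<le> real h * a" using that by (intro mult_right_mono_neg) auto
    then have "\<rho> powr (real h * a) \<le> \<rho> powr (real H * a)"
      using assms by (intro powr_mono') auto
    then show ?thesis by simp
  qed
  then have "(\<Sum>h<H. \<rho> powr (real h * a)) \<le> (\<Sum>h<H. max (\<rho> powr (real H * a)) (real H))"
    by (intro sum_mono) auto
  then show ?thesis by simp
qed

text \<open>A geometric series with ratio above \<open>1\<close> is comparable to its value at the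
  upper end, so the logarithmic part of the regret acquires no factor \<open>H\<close>.\<close>

lemma sum_powr_neg_le:
  fixes \<rho> a :: real
  assumes "0 < \<rho>" "\<rho> < 1" "a > 0"
  shows "(\<Sum>h<H. \<rho> powr (- real h * a)) \<le> \<rho> powr (- real H * a) / (\<rho> powr (- a) - 1)"
proof -
  define q where "q = \<rho> powr (- a)"
  have q: "q > 1"
    using assms powr_less_mono'[of \<rho> "- a" 0] by (simp add: q_def)
  have pow: "\<rho> powr (- real h * a) = q ^ h" for h
    using assms by (simp add: q_def powr_powr mult.commute flip: powr_realpow)
  have "(\<Sum>h<H. q ^ h) = (q ^ H - 1) / (q - 1)"
    using q by (intro geometric_sum) simp
  also have "\<dots> \<le> q ^ H / (q - 1)"
    using q by (intro divide_right_mono) auto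
  finally show ?thesis unfolding pow by (simp add: q_def)
qed

section \<open>Expected regret\<close>

locale ld_hoo_lipschitz_bandit =
  ld_hoo_bandit M F A K P \<nu>1 \<rho> H node X Y f + weakly_lipschitz_cells "space A" f xs l P \<nu>1 \<rho>
  for M :: "'w measure" and F :: "nat \<Rightarrow> 'w measure" and A :: "'a measure"
    and K :: "'a \<Rightarrow> real measure" and P \<nu>1 \<rho> H node X Y f xs l
begin

lemma trajectory:
  assumes "\<omega> \<in> space M"
  shows "ld_hoo_trajectory (space A) f xs l P \<nu>1 \<rho> H (\<lambda>s. node s \<omega>) (\<lambda>s. X s \<omega>) (\<lambda>s. Y s \<omega>)"
  using assms by unfold_locales (simp_all add: node_selected action_in_cell)

lemma regret_nonneg: "\<omega> \<in> space M \<Longrightarrow> 0 \<le> regret f xs X n \<omega>"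
proof -
  assume "\<omega> \<in> space M"
  then have "(\<Sum>t=1..n. f (X t \<omega>)) \<le> (\<Sum>t=1..n. f xs)"
    using maximizer X_in_space by (intro sum_mono) (auto simp: is_maximizer_def)
  then show ?thesis by (simp add: regret_def)
qed

lemma regret_integrable: "integrable M (regret f xs X n)"
proof -
  have "integrable M (\<lambda>\<omega>. f (X t \<omega>))" if "t \<ge> 1" for t
    using f_unit X_in_space[OF that] F_borel_measurable[OF mean_measurable[OF that]]
    by (intro integrable_const_bound[of _ 1] AE_I2) auto
  then show ?thesis
    unfolding regret_def[abs_def] by (intro Bochner_Integration.integrable_diff Bochner_Integration.integrable_sum) auto
qed

text \<open>Summability makes the deviations at a node cost a constant, uniformly in
  \<open>n\<close>. The series includes \<open>t = 0\<close>, where division by zero yields the term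
  \<open>0\<close>.\<close>

lemma sum_integral_deviation_le:
  "(\<Sum>t=1..n. (LINT \<omega>|M. deviation v t \<omega>)) \<le> (\<Sum>t. 2 / real t ^ 3)"
proof -
  have "(\<Sum>t=1..n. (LINT \<omega>|M. deviation v t \<omega>)) \<le> (\<Sum>t=1..n. 2 / real t ^ 3)"
    by (intro sum_mono integral_deviation_le) auto
  also have "\<dots> \<le> (\<Sum>t. 2 / real t ^ 3)"
    using inverse_power_summable[of 3, where 'a = real]
    by (intro sum_le_suminf) (auto simp: divide_inverse intro: summable_mult)
  finally show ?thesis .
qed

text \<open>The optimal branch and the sets of near-optimal and boundary nodes do not depend on the
  realisation, so the pathwise bound can be integrated term by term; every node whose deviations are
  counted then costs at most \<open>Z\<close>.\<close>

lemma expected_regret_le: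
  fixes n :: nat
  defines "Z \<equiv> \<Sum>t. 2 / real t ^ 3"
  assumes n: "n \<ge> 1"
  shows "(LINT \<omega>|M. regret f xs X n \<omega>) \<le> real H * Z + 4 * \<nu>1 * \<rho> ^ H * real n
    + (\<Sum>h<H. 4 * \<nu>1 * \<rho> ^ h * (real (card (near_optimal_nodes h))
        + real (card (boundary_nodes h)) * (8 * ln (real n) / (\<nu>1 * \<rho> ^ Suc h)\<^sup>2 + 1 + Z)))"
proof -
  obtain os where os: "os 0 = (0, 0)" "\<And>s. os (Suc s) \<in> children (os s)" "\<And>s. fst (os s) = s"
    "\<And>s. valid_node (os s)" "\<And>s. xs \<in> cell (os s)"
    using optimal_branch_exists by blast
  define R where "R \<omega> = (\<Sum>s=1..H. \<Sum>t=1..n. deviation (os s) t \<omega>)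
    + 4 * \<nu>1 * \<rho> ^ H * real n
    + (\<Sum>h<H. 4 * \<nu>1 * \<rho> ^ h * (real (card (near_optimal_nodes h))
        + (\<Sum>c\<in>boundary_nodes h. 8 * ln (real n) / (\<nu>1 * \<rho> ^ Suc h)\<^sup>2 + 1
            + (\<Sum>t=1..n. deviation c t \<omega>))))" for \<omega>
  have "(LINT \<omega>|M. regret f xs X n \<omega>) \<le> (LINT \<omega>|M. R \<omega>)"
  proof (rule integral_mono)
    fix \<omega> assume "\<omega> \<in> space M"
    then interpret T: ld_hoo_trajectory "space A" f xs l P \<nu>1 \<rho> H "\<lambda>s. node s \<omega>" "\<lambda>s. X s \<omega>" "\<lambda>s. Y s \<omega>"
      by (rule trajectory)
    have "(\<Sum>t=1..n. f xs - f (X t \<omega>)) \<le> R \<omega>"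
      unfolding R_def deviation_def by (rule T.trajectory_regret_le[OF n f_unit os])
    then show "regret f xs X n \<omega> \<le> R \<omega>"
      by (simp add: regret_def sum_subtractf)
  qed (auto simp: R_def[abs_def] regret_integrable deviation_integrable
      intro!: Bochner_Integration.integrable_add Bochner_Integration.integrable_sum integrable_mult_right)
  also have "(LINT \<omega>|M. R \<omega>) = (\<Sum>s=1..H. \<Sum>t=1..n. (LINT \<omega>|M. deviation (os s) t \<omega>))
    + 4 * \<nu>1 * \<rho> ^ H * real n
    + (\<Sum>h<H. 4 * \<nu>1 * \<rho> ^ h * (real (card (near_optimal_nodes h))
        + (\<Sum>c\<in>boundary_nodes h. 8 * ln (real n) / (\<nu>1 * \<rho> ^ Suc h)\<^sup>2 + 1
            + (\<Sum>t=1..n. (LINT \<omega>|M. deviation c t \<omega>)))))"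
    by (simp add: R_def[abs_def] deviation_integrable prob_space)
  also have "\<dots> \<le> (\<Sum>s=1..H. Z) + 4 * \<nu>1 * \<rho> ^ H * real n
    + (\<Sum>h<H. 4 * \<nu>1 * \<rho> ^ h * (real (card (near_optimal_nodes h))
        + (\<Sum>c\<in>boundary_nodes h. 8 * ln (real n) / (\<nu>1 * \<rho> ^ Suc h)\<^sup>2 + 1 + Z)))"
    using sum_integral_deviation_le \<nu>1_pos \<rho>_pos unfolding Z_def
    by (intro add_mono sum_mono mult_left_mono order_refl) auto
  finally show ?thesis by simp
qed

end

section \<open>The regret bound with explicit constants\<close>

lemma weakly_lipschitz_cellsI:
  assumes "is_maximizer S f xs" "binary_partition S P" "weakly_lipschitz S l f xs"
    and wsc: "well_shaped_cells S l P \<nu>1 \<nu>2 \<rho>"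
  shows "weakly_lipschitz_cells S f xs l P \<nu>1 \<rho>"
proof
  show "l x x' \<le> \<nu>1 * \<rho> ^ h" if "i < 2 ^ h" "x \<in> P h i" "x' \<in> P h i" for h i x x'
    using wsc that unfolding well_shaped_cells_def by (blast intro: sm_diam_imp_dist_le)
qed (use assms in \<open>auto simp: well_shaped_cells_def\<close>)

theorem theorem1:
  fixes A :: "'a measure" and K :: "'a \<Rightarrow> real measure"
    and f :: "'a \<Rightarrow> real" and xs :: 'a
    and l :: "'a \<Rightarrow> 'a \<Rightarrow> real" and P :: "nat \<Rightarrow> nat \<Rightarrow> 'a set"
    and \<nu>1 \<nu>2 \<rho> d :: real
  assumes env: "bandit_env A K f"
    and maximizer: "is_maximizer (space A) f xs"
    and cells: "binary_partition (space A) P"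
    and A1: "semi_metric_on (space A) l"
    and A2: "well_shaped_cells (space A) l P \<nu>1 \<nu>2 \<rho>"
    and A3: "weakly_lipschitz (space A) l f xs"
    and dim: "near_optimality_dim (space A) l f xs (4 * \<nu>1 / \<nu>2) \<nu>2 = ereal d"
    and dim_attained: "packing_exponent (space A) l f xs (4 * \<nu>1 / \<nu>2) \<nu>2 d"
  shows "\<exists>C>0. \<forall>n>0. \<forall>H>0. \<forall>(M :: 'w measure) F node X Y.
           ld_hoo_run M F A K P \<nu>1 \<rho> H node X Y \<longrightarrow>
           \<bar>LINT \<omega>|M. regret f xs X n \<omega>\<bar>
             \<le> C * (\<rho> ^ H * real n
                     + \<rho> powr (- real H * (d + 1)) * ln (real n)
                     + real H * max (\<rho> powr (real H * (1 - d))) (real H))"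
proof -
  interpret weakly_lipschitz_cells "space A" f xs l P \<nu>1 \<rho>
    by (rule weakly_lipschitz_cellsI[OF maximizer cells A3 A2])
  have d: "d \<ge> 0" using near_optimality_dim_nonneg[of "space A" l f xs] dim by (metis ereal_less_eq(5))
  obtain \<kappa> where \<kappa>: "\<kappa> > 0"
    "\<And>h. real (card (near_optimal_nodes h)) \<le> \<kappa> * \<rho> powr (- (real h * d))"
    using card_near_optimal_nodes_le[OF A2 dim_attained] by blast
  define Z where "Z = (\<Sum>t. 2 / real t ^ 3)"
  have Z: "Z \<ge> 0"
    unfolding Z_def using inverse_power_summable[of 3, where 'a = real]
    by (intro suminf_nonneg) (auto simp: divide_inverse intro: summable_mult)
  \<comment> \<open>In \<open>a\<close>, near-optimal nodes contribute \<open>1\<close> and the at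
    most twice as many boundary nodes \<open>2 * (1 + Z)\<close>. In \<open>b\<close>,
    \<open>64\<close> is \<open>4 * 2 * 8\<close>: the gap constant, the boundary nodes and the
    visit bound. \<open>q\<close> is the denominator of the geometric sum.\<close>
  define a where "a = 4 * \<nu>1 * \<kappa> * (3 + 2 * Z)"
  define b where "b = 64 * \<kappa> / (\<nu>1 * \<rho>\<^sup>2)"
  define q where "q = \<rho> powr (- (d + 1)) - 1"
  have q: "q > 0"
    using d \<rho>_pos \<rho>_less_1 powr_less_mono'[of \<rho> "- (d + 1)" 0] by (simp add: q_def)
  have ab: "a > 0" "b > 0" using \<nu>1_pos \<rho>_pos \<kappa>(1) Z by (auto simp: a_def b_def)
  have bound: "\<bar>LINT \<omega>|M. regret f xs X n \<omega>\<bar> \<le> (Z + 4 * \<nu>1 + a + b / q) *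
      (\<rho> ^ H * real n + \<rho> powr (- real H * (d + 1)) * ln (real n)
        + real H * max (\<rho> powr (real H * (1 - d))) (real H))"
    if n: "n > 0" and H: "H > 0" and run: "ld_hoo_run M F A K P \<nu>1 \<rho> H node X Y"
    for n H and M :: "'w measure" and F node X Y
  proof -
    interpret R: ld_hoo_run M F A K P \<nu>1 \<rho> H node X Y by (rule run)
    interpret R: ld_hoo_lipschitz_bandit M F A K P \<nu>1 \<rho> H node X Y f xs l
      by unfold_locales (rule env)
    define T1 where "T1 = \<rho> ^ H * real n"
    define T2 where "T2 = \<rho> powr (- real H * (d + 1)) * ln (real n)"
    define T3 where "T3 = real H * max (\<rho> powr (real H * (1 - d))) (real H)"
    \<comment> \<open>The maximum in \<open>T3\<close> is at least \<open>H \<ge> 1\<close>, so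
      \<open>T3\<close> absorbs the deviation cost \<open>Z * H\<close> of the optimal
      branch.\<close>
    have T: "T1 \<ge> 0" "T2 \<ge> 0" "T3 \<ge> real H"
    proof -
      have "real H * 1 \<le> real H * max (\<rho> powr (real H * (1 - d))) (real H)"
        using H by (intro mult_left_mono) auto
      then show "T3 \<ge> real H" by (simp add: T3_def)
    qed (use \<rho>_pos n in \<open>auto simp: T1_def T2_def\<close>)
    have level: "4 * \<nu>1 * \<rho> ^ h * (real (card (near_optimal_nodes h))
        + real (card (boundary_nodes h)) * (8 * ln (real n) / (\<nu>1 * \<rho> ^ Suc h)\<^sup>2 + 1 + Z))
      \<le> a * \<rho> powr (real h * (1 - d)) + b * ln (real n) * \<rho> powr (- real h * (d + 1))" for h
    proof -
      define L where "L = 8 * ln (real n) / (\<nu>1 * \<rho> ^ Suc h)\<^sup>2"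
      have L: "L \<ge> 0" using n by (simp add: L_def)
      have "real (card (boundary_nodes h)) \<le> 2 * real (card (near_optimal_nodes h))"
        using card_boundary_nodes_le[of h] by linarith
      then have "real (card (near_optimal_nodes h)) + real (card (boundary_nodes h)) * (L + 1 + Z)
          \<le> real (card (near_optimal_nodes h)) + 2 * real (card (near_optimal_nodes h)) * (L + 1 + Z)"
        using L Z by (intro add_left_mono mult_right_mono) auto
      also have "\<dots> = real (card (near_optimal_nodes h)) * (3 + 2 * Z + 2 * L)"
        by (simp add: algebra_simps)
      also have "\<dots> \<le> \<kappa> * \<rho> powr (- (real h * d)) * (3 + 2 * Z + 2 * L)"
        using \<kappa>(2) L Z by (intro mult_right_mono) auto
      finally have "4 * \<nu>1 * \<rho> ^ h * (real (card (near_optimal_nodes h))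
            + real (card (boundary_nodes h)) * (L + 1 + Z))
          \<le> 4 * \<nu>1 * \<rho> ^ h * (\<kappa> * \<rho> powr (- (real h * d)) * (3 + 2 * Z + 2 * L))"
        using \<nu>1_pos \<rho>_pos by (intro mult_left_mono) auto
      also have "\<dots> = a * (\<rho> ^ h * \<rho> powr (- (real h * d)))
          + b * ln (real n) * (\<rho> powr (- (real h * d)) / \<rho> ^ h)"
        using \<nu>1_pos \<rho>_pos
        by (simp add: a_def b_def L_def field_simps power2_eq_square)
      also have "\<rho> ^ h * \<rho> powr (- (real h * d)) = \<rho> powr (real h * (1 - d))"
        using \<rho>_pos by (simp add: right_diff_distrib flip: powr_realpow powr_add)
      also have "\<rho> powr (- (real h * d)) / \<rho> ^ h = \<rho> powr (- real h * (d + 1))"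
        using \<rho>_pos by (simp add: distrib_left flip: powr_realpow powr_diff)
      finally show ?thesis by (simp add: L_def)
    qed
    have "\<bar>LINT \<omega>|M. regret f xs X n \<omega>\<bar> = (LINT \<omega>|M. regret f xs X n \<omega>)"
      by (intro abs_of_nonneg Bochner_Integration.integral_nonneg R.regret_nonneg)
    also have "\<dots> \<le> real H * Z + 4 * \<nu>1 * \<rho> ^ H * real n
      + (\<Sum>h<H. 4 * \<nu>1 * \<rho> ^ h * (real (card (near_optimal_nodes h))
        + real (card (boundary_nodes h)) * (8 * ln (real n) / (\<nu>1 * \<rho> ^ Suc h)\<^sup>2 + 1 + Z)))"
      unfolding Z_def using n by (intro R.expected_regret_le) auto
    also have "\<dots> \<le> real H * Z + 4 * \<nu>1 * \<rho> ^ H * real n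
      + (\<Sum>h<H. a * \<rho> powr (real h * (1 - d)) + b * ln (real n) * \<rho> powr (- real h * (d + 1)))"
      by (intro add_left_mono sum_mono level)
    also have "\<dots> = Z * real H + 4 * \<nu>1 * T1 + a * (\<Sum>h<H. \<rho> powr (real h * (1 - d)))
      + b * ln (real n) * (\<Sum>h<H. \<rho> powr (- real h * (d + 1)))"
      by (simp add: sum.distrib sum_distrib_left T1_def)
    also have "\<dots> \<le> Z * T3 + 4 * \<nu>1 * T1 + a * T3
      + b * ln (real n) * (\<rho> powr (- real H * (d + 1)) / q)"
    proof (intro add_mono mult_left_mono order_refl)
      show "(\<Sum>h<H. \<rho> powr (real h * (1 - d))) \<le> T3"
        unfolding T3_def using \<rho>_pos \<rho>_less_1 H by (rule sum_powr_le_max)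
      show "(\<Sum>h<H. \<rho> powr (- real h * (d + 1))) \<le> \<rho> powr (- real H * (d + 1)) / q"
        unfolding q_def using \<rho>_pos \<rho>_less_1 d by (intro sum_powr_neg_le) auto
    qed (use T Z ab n \<nu>1_pos in auto)
    also have "b * ln (real n) * (\<rho> powr (- real H * (d + 1)) / q) = b / q * T2"
      by (simp add: T2_def)
    also have "Z * T3 + 4 * \<nu>1 * T1 + a * T3 + b / q * T2
        \<le> (Z + 4 * \<nu>1 + a + b / q) * (T1 + T2 + T3)"
    proof -
      have T3: "T3 \<ge> 0" using T by simp
      define r where "r = b / q"
      have r: "r > 0" using ab q by (simp add: r_def)
      have "0 \<le> Z * (T1 + T2) + 4 * \<nu>1 * (T2 + T3) + a * (T1 + T2) + r * (T1 + T3)"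
        using T T3 r Z ab \<nu>1_pos by (intro add_nonneg_nonneg mult_nonneg_nonneg) auto
      then show ?thesis unfolding r_def[symmetric] by (simp add: algebra_simps)
    qed
    finally show ?thesis by (simp only: T1_def T2_def T3_def)
  qed
  have "Z + 4 * \<nu>1 + a + b / q > 0" using Z \<nu>1_pos ab q by (intro add_nonneg_pos add_pos_pos) auto
  then show ?thesis using bound by blast
qed

end
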